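(* Let $\eta > 1$ and let $0 < \alpha < 1 - 1/\eta$ be fixed. Then there exist constants $C > 0$ and $c > 0$, depending only on $\alpha$ and $\eta$, such that for all integers $n > r \geq 1$ there exists a positive integer $d \leq C\,(r \log n)^{1/\alpha}$ (depending only on $n, r, \alpha, \eta$) with the following property. Let $D \ge r$ be any integer, let $\mathcal S_1, \dots, \mathcal S_n$ be any $n$ linear subspaces of dimension $r$ in $\mathbb{R}^D$, and let $\mathbf q \in \mathbb{R}^D$ be any query point. Let $\xi_{1'} \leq \xi_{2'} \leq \cdots \leq \xi_{n'}$ denote the $\ell^1$ distances $d_{\ell^1}(\mathbf q, \mathcal S_1), \dots, d_{\ell^1}(\mathbf q, \mathcal S_n)$ arranged in ascending order (with multiplicity), and suppose that $\xi_{1'} > 0$ and $\xi_{2'}/\xi_{1'} \geq \eta$. If $\mathbf P \in \mathbb{R}^{d \times D}$ is a random matrix whose entries are independent standard Cauchy random variables, then with probability at least $c$, $$\mathop{\arg\min}_{i \in \{1,\dots,n\}} d_{\ell^1}\left(\mathbf P \mathbf q, \mathbf P \mathcal S_i\right) = \mathop{\arg\min}_{i \in \{1,\dots,n\}} d_{\ell^1}\left(\mathbf q, \mathcal S_i\right).$$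
   Context: For a point $\mathbf x \in \mathbb{R}^m$ and a linear subspace $\mathcal S \subseteq \mathbb{R}^m$, the $\ell^1$ distance is $d_{\ell^1}(\mathbf x, \mathcal S) = \min_{\mathbf v \in \mathcal S} \|\mathbf x - \mathbf v\|_1$, where $\|\cdot\|_1$ is the $\ell^1$ norm. For a matrix $\mathbf P \in \mathbb{R}^{d \times D}$ and a subspace $\mathcal S \subseteq \mathbb{R}^D$, $\mathbf P \mathcal S = \{\mathbf P \mathbf v : \mathbf v \in \mathcal S\} \subseteq \mathbb{R}^d$, so that $d_{\ell^1}(\mathbf P\mathbf q, \mathbf P \mathcal S) = \min_{\mathbf v \in \mathcal S} \|\mathbf P \mathbf q - \mathbf P \mathbf v\|_1$. The standard Cauchy distribution is the distribution on $\mathbb{R}$ with density $p(x) = 1/[\pi(1 + x^2)]$. Here $\arg\min$ denotes the set of minimizing indices; on the right-hand side of the displayed equation it is a single index, because of the assumption $\xi_{2'}/\xi_{1'} \geq \eta > 1$. *)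

theory Defs
  imports "HOL-Probability.Probability" "Jordan_Normal_Form.VS_Connect"
begin

definition l1_norm :: "real vec \<Rightarrow> real" where
  "l1_norm v = (\<Sum>i<dim_vec v. \<bar>v $ i\<bar>)"

text \<open>For a linear subspace of \<open>\<real>\<^sup>m\<close> the infimum is attained (finite-dimensional subspaces are
  closed), so it is the minimum.\<close>
definition l1_dist :: "real vec \<Rightarrow> real vec set \<Rightarrow> real" where
  "l1_dist x S = (INF v\<in>S. l1_norm (x - v))"

text \<open>\<open>r\<close>-dimensional linear subspaces of \<open>\<real>\<^sup>m\<close>.\<close>
definition linear_subspace_of_dim :: "nat \<Rightarrow> nat \<Rightarrow> real vec set \<Rightarrow> bool" where
  "linear_subspace_of_dim m r S \<longleftrightarrow>
     VectorSpace.subspace class_ring S (module_vec TYPE(real) m) \<and>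
     vectorspace.dim class_ring ((module_vec TYPE(real) m)\<lparr>carrier := S\<rparr>) = r"

definition arg_min_set :: "('i \<Rightarrow> real) \<Rightarrow> 'i set \<Rightarrow> 'i set" where
  "arg_min_set f A = {i. is_arg_min f (\<lambda>i. i \<in> A) i}"

definition cauchy_density :: "real \<Rightarrow> real" where
  "cauchy_density x = 1 / (pi * (1 + x\<^sup>2))"

definition std_cauchy :: "real measure" where
  "std_cauchy = density lborel (\<lambda>x. ennreal (cauchy_density x))"

text \<open>The joint law of the entries of a \<open>d \<times> D\<close> matrix with independent standard Cauchy entries; a
  sample point \<open>\<omega>\<close> stands for the matrix \<open>mat d D \<omega>\<close> with entries \<open>\<omega> (i, j)\<close>. The lemma
  \<open>distr_cauchy_entries\<close> shows that every such random matrix, on any probability space, has this law.\<close>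
definition cauchy_matrix_law :: "nat \<Rightarrow> nat \<Rightarrow> (nat \<times> nat \<Rightarrow> real) measure" where
  "cauchy_matrix_law d D = PiM ({..<d} \<times> {..<D}) (\<lambda>_. std_cauchy)"

lemma prob_space_std_cauchy: "prob_space std_cauchy"
proof
  have eq: "cauchy_density = (\<lambda>x. inverse (1 + x\<^sup>2) / pi)"
    by (auto simp: cauchy_density_def fun_eq_iff field_simps)
  have int: "integrable lborel (\<lambda>x::real. inverse (1 + x\<^sup>2))"
    using integrable_inverse_1_plus_square by (simp add: set_integrable_def)
  have "(LINT x|lborel. inverse (1 + x\<^sup>2)) = pi"
    using LBINT_inverse_1_plus_square
    by (simp add: interval_lebesgue_integral_def set_lebesgue_integral_def)
  then have "(LINT x|lborel. cauchy_density x) = 1"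
    unfolding eq by simp
  moreover have "integrable lborel cauchy_density"
    unfolding eq using int by simp
  moreover have "cauchy_density x \<ge> 0" for x
    by (simp add: cauchy_density_def)
  ultimately have "(\<integral>\<^sup>+x. ennreal (cauchy_density x) \<partial>lborel) = 1"
    by (simp add: nn_integral_eq_integral)
  then show "emeasure std_cauchy (space std_cauchy) = 1"
    by (simp add: std_cauchy_def emeasure_density cauchy_density_def)
qed

lemma prob_space_cauchy_matrix_law: "prob_space (cauchy_matrix_law d D)"
  unfolding cauchy_matrix_law_def by (intro prob_space_PiM prob_space_std_cauchy)

lemma (in prob_space) distr_cauchy_entries:
  assumes pos: "d > 0" "D > 0"
    and indep: "indep_vars (\<lambda>_. borel) X ({..<d} \<times> {..<D})"
    and distr: "\<And>ij. ij \<in> {..<d} \<times> {..<D} \<Longrightarrow> distributed M lborel (X ij) cauchy_density"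
  shows "distr M (PiM ({..<d} \<times> {..<D}) (\<lambda>_. borel)) (\<lambda>\<omega>. \<lambda>ij\<in>{..<d} \<times> {..<D}. X ij \<omega>)
    = cauchy_matrix_law d D"
proof -
  have rv: "random_variable borel (X ij)" if "ij \<in> {..<d} \<times> {..<D}" for ij
    using indep that unfolding indep_vars_def2 by blast
  have marginal: "distr M borel (X ij) = std_cauchy" if "ij \<in> {..<d} \<times> {..<D}" for ij
    using distributed_distr_eq_density[OF distr[OF that]]
    by (simp add: std_cauchy_def cong: distr_cong)
  have "{..<d} \<times> {..<D} \<noteq> {}"
    using pos by auto
  from indep_vars_iff_distr_eq_PiM'[OF this rv] indep
  show ?thesis
    by (simp add: cauchy_matrix_law_def marginal cong: PiM_cong)
qed

end

theory Submission
  imports Defs "HOL-Real_Asymp.Real_Asymp"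
begin

text \<open>By stability of the Cauchy law, the entries of \<open>P x\<close> are independent Cauchy variables of scale
  \<open>\<parallel>x\<parallel>\<^sub>1\<close>, so \<open>\<parallel>P x\<parallel>\<^sub>1\<close> is typically about \<open>(2/\<pi>) d ln d \<parallel>x\<parallel>\<^sub>1\<close>. Truncating the entries at \<open>K d\<close>
  and applying Markov's inequality, it exceeds \<open>1 + \<epsilon>\<close> times this value with probability bounded away
  from 1; this is applied to the best residual only. Truncating at \<open>d powr (1 - \<alpha>)\<close> instead, the
  Chernoff bound shows that it falls below \<open>(1 - \<epsilon>) (1 - \<alpha>)\<close> times this value only with probability
  \<open>exp (- \<Omega>(d powr \<alpha> ln d))\<close>. The latter survives a union bound over nets of the \<open>n\<close> spaces spanned by
  \<open>S i\<close> and \<open>q\<close>, whose mesh can be polynomial in \<open>n\<close> and \<open>d\<close> because each space has an almost Auerbach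
  basis, on which \<open>P\<close> is polynomially bounded with high probability. The gap \<open>\<eta> (1 - \<alpha>) > 1\<close>
  separates the two estimates.\<close>

section \<open>Stability of the Cauchy distribution\<close>

text \<open>A Cauchy tail decays only like \<open>1 / t\<close>. An upper bound on a sketched norm
  therefore cannot survive a union bound, and no two-sided estimate is available on a whole
  subspace. This forces the asymmetry: the upper estimate concerns one vector fixed before
  \<open>P\<close> is drawn, and its failure probability, about \<open>1 / (1 + e)\<close>, is what
  makes \<open>c\<close> a constant smaller than 1. The net argument meets the same obstacle:
  rounding errors can only be controlled by a crude bound on \<open>P\<close> that is polynomial in
  \<open>n\<close> and \<open>d\<close>. This is affordable because the mesh enters through its
  logarithm. Each net has at most \<open>(4 * M + 1) ^ (r + 1)\<close> points with \<open>M\<close>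
  polynomial in \<open>n\<close> and \<open>d\<close>, so the union bound costs an exponent of order
  \<open>r * (ln n + ln d)\<close>. The lower tail supplies \<open>d powr \<alpha> * ln d\<close>,
  whose factor \<open>ln d\<close> comes from the truncated mean and absorbs the \<open>ln d\<close>
  of the mesh; hence \<open>d powr \<alpha>\<close> of order \<open>r * ln n\<close> suffices. The
  nets live in coefficient space, so their size is independent of \<open>D\<close>.\<close>

lemma nn_integral_FTC_UNIV:
  fixes f F :: "real \<Rightarrow> real"
  assumes deriv: "\<And>x. (F has_real_derivative f x) (at x)"
    and cont: "\<And>x. isCont f x"
    and nonneg: "\<And>x. f x \<ge> 0"
    and A: "(F \<longlongrightarrow> A) at_bot" and B: "(F \<longlongrightarrow> B) at_top"
  shows "(\<integral>\<^sup>+x. ennreal (f x) \<partial>lborel) = ennreal (B - A)"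
proof -
  have "((F \<circ> real_of_ereal) \<longlongrightarrow> A) (at_right (-\<infinity>))" "((F \<circ> real_of_ereal) \<longlongrightarrow> B) (at_left \<infinity>)"
    using A B by (simp_all add: ereal_tendsto_simps)
  from interval_integral_FTC_nonneg[of "-\<infinity>" \<infinity>, OF _ deriv cont _ this]
  have "set_integrable lborel (einterval (-\<infinity>) \<infinity>) f" "(LBINT x=-\<infinity>..\<infinity>. f x) = B - A"
    using nonneg by auto
  then have "integrable lborel f" "(LINT x|lborel. f x) = B - A"
    by (simp_all add: set_integrable_def interval_lebesgue_integral_def set_lebesgue_integral_def)
  then show ?thesis
    using nonneg by (subst nn_integral_eq_integral) auto
qed

text \<open>The law of \<open>a\<close> times a standard Cauchy variable, for \<open>a > 0\<close>.
  At \<open>a = 0\<close> the formula gives the zero function instead of a point mass, which is why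
  vectors of norm 0 are treated separately below.\<close>

definition cauchy_scale_density :: "real \<Rightarrow> real \<Rightarrow> real" where
  "cauchy_scale_density a x = a / (pi * (a\<^sup>2 + x\<^sup>2))"

lemma cauchy_scale_density_nonneg: "a \<ge> 0 \<Longrightarrow> cauchy_scale_density a x \<ge> 0"
  by (simp add: cauchy_scale_density_def)

lemma measurable_cauchy_scale_density [measurable]: "cauchy_scale_density a \<in> borel_measurable borel"
  unfolding cauchy_scale_density_def by measurable

text \<open>The partial fraction decomposition of the integrand degenerates for \<open>z = 0\<close>, \<open>a = b\<close>.\<close>
lemma cauchy_convolution_integral:
  assumes a: "a > 0" and b: "b > 0" and z: "z \<noteq> 0"
  shows "(\<integral>\<^sup>+y. ennreal (cauchy_scale_density a (z - y)) * ennreal (cauchy_scale_density b y) \<partial>lborel)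
    = ennreal (cauchy_scale_density (a + b) z)"
proof -
  \<comment> \<open>\<open>\<Delta>\<close> is the resultant of the two quadratic denominators in
    \<open>y\<close>; \<open>A\<close>, \<open>E\<close> and \<open>G\<close> are the coefficients
    of the partial fractions.\<close>
  define \<Delta> where "\<Delta> = (z\<^sup>2 + (a - b)\<^sup>2) * (z\<^sup>2 + (a + b)\<^sup>2)"
  have \<Delta>: "\<Delta> > 0"
    unfolding \<Delta>_def using z by (intro mult_pos_pos add_pos_nonneg) auto
  define A where "A = 2 * z / \<Delta>"
  define E where "E = (z\<^sup>2 + a\<^sup>2 - b\<^sup>2) / \<Delta>"
  define G where "G = (z\<^sup>2 + b\<^sup>2 - a\<^sup>2) / \<Delta>"
  define f where "f y = cauchy_scale_density a (z - y) * cauchy_scale_density b y" for y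
  \<comment> \<open>The two logarithms diverge separately at infinity. They carry opposite
    coefficients, so they are merged into one quotient whose logarithm tends to 0 at both
    ends.\<close>
  define F where "F y = a * b / pi\<^sup>2 * (A / 2 * ln ((b\<^sup>2 + y\<^sup>2) / (a\<^sup>2 + (z - y)\<^sup>2))
     + E / b * arctan (y / b) + G / a * arctan ((y - z) / a))" for y
  have pos1: "b\<^sup>2 + y\<^sup>2 > 0" and pos2: "a\<^sup>2 + (z - y)\<^sup>2 > 0" for y
    using a b by (auto intro: add_pos_nonneg)
  have decomp: "1 / ((a\<^sup>2 + (z - y)\<^sup>2) * (b\<^sup>2 + y\<^sup>2))
      = (A * y + E) / (b\<^sup>2 + y\<^sup>2) + (- A * (y - z) + G) / (a\<^sup>2 + (z - y)\<^sup>2)" for y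
  proof -
    have "(A * y + E) * (a\<^sup>2 + (z - y)\<^sup>2) + (- A * (y - z) + G) * (b\<^sup>2 + y\<^sup>2)
       = ((2 * z * y + (z\<^sup>2 + a\<^sup>2 - b\<^sup>2)) * (a\<^sup>2 + (z - y)\<^sup>2)
         + (- (2 * z) * (y - z) + (z\<^sup>2 + b\<^sup>2 - a\<^sup>2)) * (b\<^sup>2 + y\<^sup>2)) / \<Delta>"
      unfolding A_def E_def G_def using \<Delta> by (simp add: field_simps)
    also have "(2 * z * y + (z\<^sup>2 + a\<^sup>2 - b\<^sup>2)) * (a\<^sup>2 + (z - y)\<^sup>2)
         + (- (2 * z) * (y - z) + (z\<^sup>2 + b\<^sup>2 - a\<^sup>2)) * (b\<^sup>2 + y\<^sup>2) = \<Delta>"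
      unfolding \<Delta>_def by (simp add: power2_eq_square algebra_simps)
    finally have "(A * y + E) * (a\<^sup>2 + (z - y)\<^sup>2) + (- A * (y - z) + G) * (b\<^sup>2 + y\<^sup>2) = 1"
      using \<Delta> by simp
    then show ?thesis
      using pos1[of y] pos2[of y] by (subst add_frac_eq) (auto simp: mult.commute)
  qed
  have deriv: "(F has_real_derivative f y) (at y)" for y
  proof -
    have 1: "((\<lambda>y. ln ((b\<^sup>2 + y\<^sup>2) / (a\<^sup>2 + (z - y)\<^sup>2))) has_real_derivative
       2 * y / (b\<^sup>2 + y\<^sup>2) - 2 * (y - z) / (a\<^sup>2 + (z - y)\<^sup>2)) (at y)"
    proof -
      have "((\<lambda>y. ln (b\<^sup>2 + y\<^sup>2) - ln (a\<^sup>2 + (z - y)\<^sup>2)) has_real_derivative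
         2 * y / (b\<^sup>2 + y\<^sup>2) - 2 * (y - z) / (a\<^sup>2 + (z - y)\<^sup>2)) (at y)"
        using pos1[of y] pos2[of y]
        by (auto intro!: derivative_eq_intros simp: divide_simps)
      moreover have "(\<lambda>y. ln ((b\<^sup>2 + y\<^sup>2) / (a\<^sup>2 + (z - y)\<^sup>2))) = (\<lambda>y. ln (b\<^sup>2 + y\<^sup>2) - ln (a\<^sup>2 + (z - y)\<^sup>2))"
        by (rule ext, rule ln_divide_pos[OF pos1 pos2])
      ultimately show ?thesis by simp
    qed
    have 2: "((\<lambda>y. arctan (y / b)) has_real_derivative b / (b\<^sup>2 + y\<^sup>2)) (at y)"
      using b pos1[of y] by (auto intro!: derivative_eq_intros simp: divide_simps power2_eq_square)
    have 3: "((\<lambda>y. arctan ((y - z) / a)) has_real_derivative a / (a\<^sup>2 + (z - y)\<^sup>2)) (at y)"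
    proof -
      have eq: "inverse (1 + ((y - z) / a)\<^sup>2) / a = a / (a\<^sup>2 + (z - y)\<^sup>2)"
      proof -
        have "1 + ((y - z) / a)\<^sup>2 = (a\<^sup>2 + (z - y)\<^sup>2) / a\<^sup>2"
          using a by (simp add: power_divide add_divide_distrib power2_commute)
        then show ?thesis
          using a by (simp add: power2_eq_square)
      qed
      have "((\<lambda>y. arctan ((y - z) / a)) has_real_derivative inverse (1 + ((y - z) / a)\<^sup>2) / a) (at y)"
        using a by (auto intro!: derivative_eq_intros simp: divide_simps)
      then show ?thesis unfolding eq .
    qed
    have "(F has_real_derivative a * b / pi\<^sup>2 * (A / 2 * (2 * y / (b\<^sup>2 + y\<^sup>2) - 2 * (y - z) / (a\<^sup>2 + (z - y)\<^sup>2))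
      + E / b * (b / (b\<^sup>2 + y\<^sup>2)) + G / a * (a / (a\<^sup>2 + (z - y)\<^sup>2)))) (at y)"
      unfolding F_def by (intro DERIV_cmult DERIV_add 1 2 3)
    also have "A / 2 * (2 * y / (b\<^sup>2 + y\<^sup>2) - 2 * (y - z) / (a\<^sup>2 + (z - y)\<^sup>2))
      + E / b * (b / (b\<^sup>2 + y\<^sup>2)) + G / a * (a / (a\<^sup>2 + (z - y)\<^sup>2))
      = (A * y + E) / (b\<^sup>2 + y\<^sup>2) + (- A * (y - z) + G) / (a\<^sup>2 + (z - y)\<^sup>2)"
      using a b by (simp add: add_divide_distrib diff_divide_distrib right_diff_distrib)
    also have "\<dots> = 1 / ((a\<^sup>2 + (z - y)\<^sup>2) * (b\<^sup>2 + y\<^sup>2))"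
      by (rule decomp[symmetric])
    also have "a * b / pi\<^sup>2 * \<dots> = f y"
      by (simp add: f_def cauchy_scale_density_def power2_eq_square)
    finally show ?thesis .
  qed
  have cont: "isCont f y" for y
    unfolding f_def cauchy_scale_density_def
    using pos1[of y] pos2[of y] by (intro continuous_intros) auto
  have nonneg: "f y \<ge> 0" for y
    unfolding f_def using a b by (intro mult_nonneg_nonneg cauchy_scale_density_nonneg) auto
  have L: "((\<lambda>y. ln ((b\<^sup>2 + y\<^sup>2) / (a\<^sup>2 + (z - y)\<^sup>2))) \<longlongrightarrow> 0) at_top"
    "((\<lambda>y. ln ((b\<^sup>2 + y\<^sup>2) / (a\<^sup>2 + (z - y)\<^sup>2))) \<longlongrightarrow> 0) at_bot"
    by real_asymp+
  have T: "((\<lambda>y. arctan (y / b)) \<longlongrightarrow> pi / 2) at_top" "((\<lambda>y. arctan (y / b)) \<longlongrightarrow> - (pi / 2)) at_bot"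
    "((\<lambda>y. arctan ((y - z) / a)) \<longlongrightarrow> pi / 2) at_top" "((\<lambda>y. arctan ((y - z) / a)) \<longlongrightarrow> - (pi / 2)) at_bot"
    using a b by real_asymp+
  have "(F \<longlongrightarrow> a * b / pi\<^sup>2 * (A / 2 * 0 + E / b * (pi / 2) + G / a * (pi / 2))) at_top"
    "(F \<longlongrightarrow> a * b / pi\<^sup>2 * (A / 2 * 0 + E / b * (- (pi / 2)) + G / a * (- (pi / 2)))) at_bot"
    unfolding F_def by (intro tendsto_intros L T)+
  from nn_integral_FTC_UNIV[OF deriv cont nonneg this(2,1)]
  have "(\<integral>\<^sup>+y. ennreal (f y) \<partial>lborel) = ennreal (a * b / pi * (E / b + G / a))"
    by (simp add: power2_eq_square algebra_simps)
  also have "a * b / pi * (E / b + G / a) = (a * E + b * G) / pi"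
    using a b by (simp add: field_simps)
  \<comment> \<open>The factor \<open>z\<^sup>2 + (a - b)\<^sup>2\<close> of \<open>\<Delta>\<close>
    cancels, and what is left is the Cauchy density of scale \<open>a + b\<close>.\<close>
  also have "a * E + b * G = (a + b) * (z\<^sup>2 + (a - b)\<^sup>2) / \<Delta>"
    unfolding E_def G_def by (simp add: algebra_simps power2_eq_square add_divide_distrib diff_divide_distrib)
  also have "\<dots> = (a + b) / (z\<^sup>2 + (a + b)\<^sup>2)"
    using z unfolding \<Delta>_def by (simp add: add_nonneg_eq_0_iff)
  also have "\<dots> / pi = cauchy_scale_density (a + b) z"
    by (simp add: cauchy_scale_density_def add.commute mult.commute)
  finally show ?thesis
    using a b by (simp add: f_def ennreal_mult cauchy_scale_density_nonneg)
qed

lemma (in prob_space) add_indep_cauchy: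
  assumes indep: "indep_var borel X borel Y"
    and ab: "a > 0" "b > 0"
    and X: "distributed M lborel X (cauchy_scale_density a)"
    and Y: "distributed M lborel Y (cauchy_scale_density b)"
  shows "distributed M lborel (\<lambda>x. X x + Y x) (cauchy_scale_density (a + b))"
proof -
  have *: "distributed M lborel (\<lambda>x. X x + Y x)
    (\<lambda>x. \<integral>\<^sup>+y. ennreal (cauchy_scale_density a (x - y)) * ennreal (cauchy_scale_density b y) \<partial>lborel)"
    by (rule distributed_convolution[OF indep X Y])
  \<comment> \<open>The convolution formula excludes the point 0, a null set, and a density matters
    only almost everywhere.\<close>
  have ae: "AE x in lborel. (\<integral>\<^sup>+y. ennreal (cauchy_scale_density a (x - y)) * ennreal (cauchy_scale_density b y) \<partial>lborel)
    = ennreal (cauchy_scale_density (a + b) x)"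
    using AE_lborel_singleton[of 0] by eventually_elim (use ab in \<open>auto intro: cauchy_convolution_integral\<close>)
  then show ?thesis
    using * by (subst (asm) distributed_cong_density) (use ae in \<open>auto simp: distributed_def\<close>)
qed

lemma (in prob_space) sum_indep_cauchy:
  assumes "finite I" "I \<noteq> {}" "indep_vars (\<lambda>i. borel) X I"
    and "\<And>i. i \<in> I \<Longrightarrow> \<sigma> i > 0"
    and "\<And>i. i \<in> I \<Longrightarrow> distributed M lborel (X i) (cauchy_scale_density (\<sigma> i))"
  shows "distributed M lborel (\<lambda>x. \<Sum>i\<in>I. X i x) (cauchy_scale_density (\<Sum>i\<in>I. \<sigma> i))"
  using assms
proof (induct I rule: finite_ne_induct)
  case (singleton i)
  then show ?case by simp
next
  case (insert i I)
  have "distributed M lborel (\<lambda>x. X i x + (\<Sum>i\<in>I. X i x)) (cauchy_scale_density (\<sigma> i + (\<Sum>i\<in>I. \<sigma> i)))"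
  proof (rule add_indep_cauchy)
    show "indep_var borel (X i) borel (\<lambda>x. \<Sum>i\<in>I. X i x)"
      using insert by (intro indep_vars_sum) auto
    show "0 < (\<Sum>i\<in>I. \<sigma> i)"
      using insert by (intro sum_pos) auto
    show "distributed M lborel (\<lambda>x. \<Sum>i\<in>I. X i x) (cauchy_scale_density (\<Sum>i\<in>I. \<sigma> i))"
      using insert by (intro insert.hyps indep_vars_subset[OF insert.prems(1)]) auto
  qed (use insert in auto)
  then show ?case
    using insert by simp
qed

section \<open>Tails of sums of absolute values\<close>

text \<open>Large values are replaced by 0, not by \<open>c\<close>: the truncated moment of a
  Cauchy variable is then a plain logarithm.\<close>

definition truncated_abs :: "real \<Rightarrow> real \<Rightarrow> real" where
  "truncated_abs c x = \<bar>x\<bar> * indicator {-c..c} x"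

lemma truncated_abs_nonneg: "truncated_abs c x \<ge> 0"
  by (simp add: truncated_abs_def)

lemma truncated_abs_le: "c \<ge> 0 \<Longrightarrow> truncated_abs c x \<le> c"
  by (auto simp: truncated_abs_def indicator_def)

lemma truncated_abs_le_abs: "truncated_abs c x \<le> \<bar>x\<bar>"
  by (auto simp: truncated_abs_def indicator_def)

lemma truncated_abs_eq_abs: "\<bar>x\<bar> \<le> c \<Longrightarrow> truncated_abs c x = \<bar>x\<bar>"
  by (auto simp: truncated_abs_def indicator_def)

lemma measurable_truncated_abs [measurable]: "truncated_abs c \<in> borel_measurable borel"
  unfolding truncated_abs_def by measurable

text \<open>A multiple of \<open>ln (s\<^sup>2 + x\<^sup>2)\<close> is an antiderivative of
  \<open>x\<close> times the density. Taking the level proportional to \<open>s\<close> makes the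
  logarithm independent of the scale, so vectors of all norms share the same constant.\<close>

lemma truncated_cauchy_moment:
  assumes s: "s > 0" and B: "B > 0"
  shows "(LINT x|lborel. cauchy_scale_density s x * truncated_abs (s * B) x) = s * ln (1 + B\<^sup>2) / pi"
proof -
  define F where "F x = s / (2 * pi) * ln (s\<^sup>2 + x\<^sup>2)" for x
  have pos: "s\<^sup>2 + x\<^sup>2 > 0" for x
    using s by (auto intro: add_pos_nonneg)
  have deriv: "(F has_real_derivative cauchy_scale_density s x * x) (at x)" for x
    unfolding F_def cauchy_scale_density_def using pos[of x]
    by (auto intro!: derivative_eq_intros simp: divide_simps)
  have "has_bochner_integral lborel (\<lambda>x. (cauchy_scale_density s x * x) * indicator {0..s * B} x) (F (s * B) - F 0)"
    using s B by (intro has_bochner_integral_FTC_Icc_nonneg deriv) (auto simp: cauchy_scale_density_nonneg)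
  moreover have "has_bochner_integral lborel (\<lambda>x. (- (cauchy_scale_density s x * x)) * indicator {- (s * B)..0} x)
      (- F 0 - - F (- (s * B)))"
    using s B by (intro has_bochner_integral_FTC_Icc_nonneg DERIV_minus deriv)
      (auto simp: cauchy_scale_density_nonneg mult_nonneg_nonpos)
  ultimately have "has_bochner_integral lborel
     (\<lambda>x. (cauchy_scale_density s x * x) * indicator {0..s * B} x
        + (- (cauchy_scale_density s x * x)) * indicator {- (s * B)..0} x)
     ((F (s * B) - F 0) + (- F 0 - - F (- (s * B))))"
    by (rule has_bochner_integral_add)
  \<comment> \<open>The two intervals overlap at 0, where the integrand vanishes.\<close>
  moreover have "(cauchy_scale_density s x * x) * indicator {0..s * B} x
        + (- (cauchy_scale_density s x * x)) * indicator {- (s * B)..0} x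
      = cauchy_scale_density s x * truncated_abs (s * B) x" for x
    using s B by (auto simp: truncated_abs_def indicator_def)
  ultimately have "(LINT x|lborel. cauchy_scale_density s x * truncated_abs (s * B) x)
    = 2 * (F (s * B) - F 0)"
    by (simp add: has_bochner_integral_integral_eq F_def)
  also have "F (s * B) - F 0 = s / (2 * pi) * (ln (s\<^sup>2 + (s * B)\<^sup>2) - ln (s\<^sup>2))"
    by (simp add: F_def right_diff_distrib)
  also have "ln (s\<^sup>2 + (s * B)\<^sup>2) - ln (s\<^sup>2) = ln ((s\<^sup>2 + (s * B)\<^sup>2) / s\<^sup>2)"
    using s pos[of "s * B"] by (subst ln_divide_pos) auto
  also have "(s\<^sup>2 + (s * B)\<^sup>2) / s\<^sup>2 = 1 + B\<^sup>2"
    using s by (simp add: power_mult_distrib add_divide_distrib)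
  finally show ?thesis by simp
qed

lemma (in prob_space) expectation_truncated_cauchy:
  assumes "distributed M lborel X (cauchy_scale_density s)" "s > 0" "B > 0"
  shows "expectation (\<lambda>\<omega>. truncated_abs (s * B) (X \<omega>)) = s * ln (1 + B\<^sup>2) / pi"
  using assms by (subst distributed_integral[OF assms(1), symmetric])
    (auto simp: truncated_cauchy_moment cauchy_scale_density_nonneg)

lemma (in prob_space) integrable_truncated_abs:
  assumes [measurable]: "X \<in> borel_measurable M" and "c \<ge> 0"
  shows "integrable M (\<lambda>\<omega>. truncated_abs c (X \<omega>))"
  using assms(2) by (intro integrable_const_bound[where B = c])
    (auto simp: truncated_abs_nonneg truncated_abs_le)

text \<open>The exact tail is \<open>2 / pi * arctan (s / t)\<close>; the bound uses
  \<open>arctan u \<le> u\<close> and drops the factor \<open>2 / pi\<close>.\<close>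

lemma (in prob_space) cauchy_tail_le:
  assumes X: "distributed M lborel X (cauchy_scale_density s)" and s: "s > 0" and t: "t > 0"
  shows "prob {\<omega> \<in> space M. \<bar>X \<omega>\<bar> > t} \<le> s / t"
proof -
  have [measurable]: "X \<in> borel_measurable M"
    using distributed_measurable[OF X] by simp
  have deriv: "((\<lambda>x. arctan (x / s) / pi) has_real_derivative cauchy_scale_density s x) (at x)" for x
  proof -
    have "inverse (1 + (x / s)\<^sup>2) * inverse s / pi = cauchy_scale_density s x"
      using s by (simp add: cauchy_scale_density_def divide_simps power2_eq_square)
    then show ?thesis
      using s by (auto intro!: derivative_eq_intros simp: divide_simps)
  qed
  have "emeasure M (X -` {-t..t} \<inter> space M) = ennreal (arctan (t / s) / pi - arctan (- t / s) / pi)"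
    using s t nn_integral_FTC_Icc[of "cauchy_scale_density s" "- t" t "\<lambda>x. arctan (x / s) / pi", OF _ deriv]
    by (subst distributed_emeasure[OF X]) (auto simp: cauchy_scale_density_nonneg)
  then have p: "prob (X -` {-t..t} \<inter> space M) = 2 * arctan (t / s) / pi"
    using s t by (simp add: measure_def arctan_minus)
  have "{\<omega> \<in> space M. \<bar>X \<omega>\<bar> > t} = space M - (X -` {-t..t} \<inter> space M)"
    by auto
  then have "prob {\<omega> \<in> space M. \<bar>X \<omega>\<bar> > t} = 1 - 2 * arctan (t / s) / pi"
    using p by (simp add: prob_compl)
  also have "arctan (t / s) = pi / 2 - arctan (s / t)"
    using s t arctan_inverse[of "s / t"] by simp
  also have "1 - 2 * (pi / 2 - arctan (s / t)) / pi = 2 / pi * arctan (s / t)"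
    by (simp add: field_simps)
  also have "\<dots> \<le> 1 * (s / t)"
    using s t pi_ge_two by (intro mult_mono arctan_le_self) (auto simp: zero_le_arctan_iff)
  finally show ?thesis by simp
qed

text \<open>The product \<open>(1 - y + y\<^sup>2 / 2) * (1 + y + y\<^sup>2 / 2)\<close> equals
  \<open>1 + y ^ 4 / 4\<close>, so the Taylor lower bound for \<open>exp y\<close> turns into an
  upper bound for its inverse.\<close>

lemma exp_minus_le_quadratic:
  fixes y :: real
  assumes "y \<ge> 0"
  shows "exp (- y) \<le> 1 - y + y\<^sup>2 / 2"
proof -
  have pos: "1 - y + y\<^sup>2 / 2 > 0"
  proof -
    have "1 - y + y\<^sup>2 / 2 = ((1 - y)\<^sup>2 + 1) / 2"
      by (simp add: power2_eq_square field_simps)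
    also have "\<dots> > 0" by (simp add: add_nonneg_pos)
    finally show ?thesis .
  qed
  have "1 \<le> 1 + y ^ 4 / 4"
    by simp
  also have "\<dots> = (1 - y + y\<^sup>2 / 2) * (1 + y + y\<^sup>2 / 2)"
    by (simp add: power2_eq_square power4_eq_xxxx field_simps)
  also have "\<dots> \<le> (1 - y + y\<^sup>2 / 2) * exp y"
    using pos exp_lower_Taylor_quadratic[OF assms] by (intro mult_left_mono) auto
  finally show ?thesis
    by (simp add: exp_minus field_simps)
qed

text \<open>Truncation only decreases the sum, so a small sum forces a small truncated sum. The
  truncated terms lie between 0 and \<open>s * B\<close>, and the Chernoff bound for them loses the
  factor \<open>1 / B\<close> in the exponent.\<close>

lemma (in prob_space) sum_abs_cauchy_lower_tail:
  fixes X :: "'i \<Rightarrow> 'a \<Rightarrow> real" and s B e \<mu> :: real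
  assumes I: "finite I" and indep: "indep_vars (\<lambda>_. borel) X I"
    and X: "\<And>i. i \<in> I \<Longrightarrow> distributed M lborel (X i) (cauchy_scale_density s)"
    and s: "s > 0" and B: "B > 0" and e: "0 < e" "e < 1"
  defines "\<mu> \<equiv> ln (1 + B\<^sup>2) / pi"
  shows "prob {\<omega> \<in> space M. (\<Sum>i\<in>I. \<bar>X i \<omega>\<bar>) \<le> (1 - e) * card I * \<mu> * s} \<le> exp (- (e\<^sup>2 / 2 * card I * \<mu> / B))"
proof -
  \<comment> \<open>With this parameter \<open>l * Y i\<close> is at most \<open>e\<close>, so the
    quadratic term of the exponential costs only the factor \<open>1 - e / 2\<close>. The exponent
    is then proportional to \<open>e * (1 - e) - e * (1 - e / 2) = - e\<^sup>2 / 2\<close>.\<close>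
  define l where "l = e / (s * B)"
  define c where "c = (1 - e / 2) * e / B * \<mu>"
  define a where "a = (1 - e) * card I * \<mu> * s"
  have l: "l > 0" using s B e by (simp add: l_def)
  define Y where "Y i \<omega> = truncated_abs (s * B) (X i \<omega>)" for i \<omega>
  have Xm [measurable]: "i \<in> I \<Longrightarrow> X i \<in> borel_measurable M" for i
    using distributed_measurable[OF X] by simp
  have Ym [measurable]: "i \<in> I \<Longrightarrow> Y i \<in> borel_measurable M" for i
    unfolding Y_def by measurable
  have Y: "0 \<le> Y i \<omega>" "Y i \<omega> \<le> s * B" for i \<omega>
    using s B by (auto simp: Y_def truncated_abs_nonneg truncated_abs_le)
  have intY: "integrable M (Y i)" if "i \<in> I" for i
    unfolding Y_def using that s B by (intro integrable_truncated_abs) auto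
  have intE: "integrable M (\<lambda>\<omega>. exp (- l * Y i \<omega>))" if "i \<in> I" for i
    using that Y l by (intro integrable_const_bound[where B = 1]) auto
  have expY: "expectation (\<lambda>\<omega>. exp (- l * Y i \<omega>)) \<le> exp (- c)" if i: "i \<in> I" for i
  proof -
    have "exp (- l * Y i \<omega>) \<le> 1 - l * (1 - e / 2) * Y i \<omega>" for \<omega>
    proof -
      define y where "y = l * Y i \<omega>"
      have "y \<ge> 0" using l Y by (simp add: y_def)
      have "y \<le> l * (s * B)" using l Y unfolding y_def by (intro mult_left_mono) auto
      then have "y \<le> e" using s B by (simp add: l_def)
      have "exp (- y) \<le> 1 - y + y\<^sup>2 / 2"
        by (rule exp_minus_le_quadratic) fact
      also have "y\<^sup>2 \<le> e * y"
        unfolding power2_eq_square using \<open>y \<ge> 0\<close> \<open>y \<le> e\<close> by (intro mult_right_mono)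
      finally show ?thesis
        by (simp add: y_def algebra_simps)
    qed
    then have "expectation (\<lambda>\<omega>. exp (- l * Y i \<omega>)) \<le> expectation (\<lambda>\<omega>. 1 - l * (1 - e / 2) * Y i \<omega>)"
      using intE[OF i] intY[OF i] by (intro integral_mono) auto
    also have "\<dots> = 1 - l * (1 - e / 2) * expectation (Y i)"
      using intY[OF i] by (simp add: prob_space)
    also have "expectation (Y i) = s * \<mu>"
      unfolding Y_def \<mu>_def using expectation_truncated_cauchy[OF X[OF i] s B] by simp
    also have "l * (1 - e / 2) * (s * \<mu>) = c"
      unfolding l_def c_def using s B by simp
    also have "1 - c \<le> exp (- c)"
      using exp_ge_add_one_self[of "- c"] by simp
    finally show ?thesis .
  qed
  have indep': "indep_vars (\<lambda>_. borel) (\<lambda>i \<omega>. exp (- l * Y i \<omega>)) I"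
    unfolding Y_def by (rule indep_vars_compose2[OF indep]) measurable
  have int: "integrable M (\<lambda>\<omega>. \<Prod>i\<in>I. exp (- l * Y i \<omega>))"
    by (rule indep_vars_integrable[OF I indep' intE])
  have "prob {\<omega> \<in> space M. (\<Sum>i\<in>I. \<bar>X i \<omega>\<bar>) \<le> a} \<le> prob {\<omega> \<in> space M. (\<Prod>i\<in>I. exp (- l * Y i \<omega>)) \<ge> exp (- l * a)}"
  proof (rule finite_measure_mono)
    show "{\<omega> \<in> space M. (\<Prod>i\<in>I. exp (- l * Y i \<omega>)) \<ge> exp (- l * a)} \<in> events"
      by measurable
    have "exp (- l * a) \<le> (\<Prod>i\<in>I. exp (- l * Y i \<omega>))" if "(\<Sum>i\<in>I. \<bar>X i \<omega>\<bar>) \<le> a" for \<omega>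
    proof -
      have "(\<Sum>i\<in>I. Y i \<omega>) \<le> (\<Sum>i\<in>I. \<bar>X i \<omega>\<bar>)"
        unfolding Y_def by (intro sum_mono truncated_abs_le_abs)
      then show ?thesis
        using that l I by (simp add: exp_sum[symmetric] sum_negf sum_distrib_left[symmetric])
    qed
    then show "{\<omega> \<in> space M. (\<Sum>i\<in>I. \<bar>X i \<omega>\<bar>) \<le> a} \<subseteq> {\<omega> \<in> space M. (\<Prod>i\<in>I. exp (- l * Y i \<omega>)) \<ge> exp (- l * a)}"
      by auto
  qed
  also have "\<dots> \<le> expectation (\<lambda>\<omega>. \<Prod>i\<in>I. exp (- l * Y i \<omega>)) / exp (- l * a)"
    by (rule integral_Markov_inequality_measure[OF int, of "{}"]) (auto intro!: AE_I2 prod_nonneg)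
  also have "expectation (\<lambda>\<omega>. \<Prod>i\<in>I. exp (- l * Y i \<omega>)) = (\<Prod>i\<in>I. expectation (\<lambda>\<omega>. exp (- l * Y i \<omega>)))"
    by (rule indep_vars_lebesgue_integral[OF I indep' intE])
  also have "(\<Prod>i\<in>I. expectation (\<lambda>\<omega>. exp (- l * Y i \<omega>))) \<le> (\<Prod>i\<in>I. exp (- c))"
    by (intro prod_mono conjI expY) auto
  also have "(\<Prod>i\<in>I. exp (- c)) / exp (- l * a) = exp (l * a - card I * c)"
    using I by (simp add: exp_of_nat_mult[symmetric] exp_diff exp_minus field_simps)
  also have "l * a - card I * c = - (e\<^sup>2 / 2 * card I * \<mu> / B)"
    unfolding l_def a_def c_def using s B by (simp add: field_simps power2_eq_square)
  finally show ?thesis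
    by (simp add: a_def divide_right_mono)
qed

text \<open>Truncation at \<open>s * (K * card I)\<close> balances two failures: some term exceeds
  the level with probability at most \<open>1 / K\<close>, and Markov's inequality for the truncated
  sum gives \<open>1 / (1 + e)\<close>. Together they stay below 1 once
  \<open>K > (1 + e) / e\<close>.\<close>

lemma (in prob_space) sum_abs_cauchy_upper_tail:
  fixes X :: "'i \<Rightarrow> 'a \<Rightarrow> real" and s K e \<mu> :: real
  assumes I: "finite I" "I \<noteq> {}"
    and X: "\<And>i. i \<in> I \<Longrightarrow> distributed M lborel (X i) (cauchy_scale_density s)"
    and s: "s > 0" and K: "K > 0" and e: "0 < e"
  defines "\<mu> \<equiv> ln (1 + (K * card I)\<^sup>2) / pi"
  shows "prob {\<omega> \<in> space M. (\<Sum>i\<in>I. \<bar>X i \<omega>\<bar>) \<ge> (1 + e) * card I * \<mu> * s} \<le> 1 / (1 + e) + 1 / K"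
proof -
  define N where "N = real (card I)"
  have N: "N > 0" using I by (simp add: N_def card_gt_0_iff)
  have \<mu>: "\<mu> > 0" using N K by (simp add: \<mu>_def N_def[symmetric] ln_gt_zero)
  define a where "a = (1 + e) * card I * \<mu> * s"
  have a: "a > 0" using \<mu> N s e unfolding a_def N_def[symmetric] by simp
  define Y where "Y i \<omega> = truncated_abs (s * (K * N)) (X i \<omega>)" for i \<omega>
  have Xm [measurable]: "i \<in> I \<Longrightarrow> X i \<in> borel_measurable M" for i
    using distributed_measurable[OF X] by simp
  have Ym [measurable]: "i \<in> I \<Longrightarrow> Y i \<in> borel_measurable M" for i
    unfolding Y_def by measurable
  have intY: "integrable M (Y i)" if "i \<in> I" for i
    unfolding Y_def using that s N K by (intro integrable_truncated_abs) auto
  have expY: "expectation (Y i) = s * \<mu>" if "i \<in> I" for i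
    unfolding Y_def \<mu>_def using expectation_truncated_cauchy[OF X[OF that] s, of "K * N"] K N
    by (simp add: N_def)
  have int: "integrable M (\<lambda>\<omega>. \<Sum>i\<in>I. Y i \<omega>)"
    by (rule Bochner_Integration.integrable_sum) (rule intY)
  have "prob {\<omega> \<in> space M. (\<Sum>i\<in>I. Y i \<omega>) \<ge> a} \<le> expectation (\<lambda>\<omega>. \<Sum>i\<in>I. Y i \<omega>) / a"
    using a by (intro integral_Markov_inequality_measure[OF int, of "{}"])
      (auto intro!: sum_nonneg simp: Y_def truncated_abs_nonneg)
  also have "expectation (\<lambda>\<omega>. \<Sum>i\<in>I. Y i \<omega>) = N * (s * \<mu>)"
    using intY by (simp add: Bochner_Integration.integral_sum expY N_def)
  also have "N * (s * \<mu>) / a = 1 / (1 + e)"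
    using N s \<mu> e unfolding a_def N_def[symmetric] by simp
  finally have 1: "prob {\<omega> \<in> space M. (\<Sum>i\<in>I. Y i \<omega>) \<ge> a} \<le> 1 / (1 + e)" .
  have "prob (\<Union>i\<in>I. {\<omega> \<in> space M. \<bar>X i \<omega>\<bar> > s * (K * N)})
      \<le> (\<Sum>i\<in>I. prob {\<omega> \<in> space M. \<bar>X i \<omega>\<bar> > s * (K * N)})"
    using I by (intro finite_measure_subadditive_finite) auto
  also have "\<dots> \<le> (\<Sum>i\<in>I. s / (s * (K * N)))"
    using s K N X by (intro sum_mono cauchy_tail_le) auto
  also have "\<dots> = 1 / K"
    using s K N by (simp add: N_def[symmetric])
  finally have 2: "prob (\<Union>i\<in>I. {\<omega> \<in> space M. \<bar>X i \<omega>\<bar> > s * (K * N)}) \<le> 1 / K" .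
  have "{\<omega> \<in> space M. (\<Sum>i\<in>I. \<bar>X i \<omega>\<bar>) \<ge> a}
     \<subseteq> {\<omega> \<in> space M. (\<Sum>i\<in>I. Y i \<omega>) \<ge> a} \<union> (\<Union>i\<in>I. {\<omega> \<in> space M. \<bar>X i \<omega>\<bar> > s * (K * N)})"
  proof (rule subsetI, rule ccontr)
    fix \<omega>
    assume *: "\<omega> \<in> {\<omega> \<in> space M. (\<Sum>i\<in>I. \<bar>X i \<omega>\<bar>) \<ge> a}"
      and "\<omega> \<notin> {\<omega> \<in> space M. (\<Sum>i\<in>I. Y i \<omega>) \<ge> a} \<union> (\<Union>i\<in>I. {\<omega> \<in> space M. \<bar>X i \<omega>\<bar> > s * (K * N)})"
    then have "(\<Sum>i\<in>I. Y i \<omega>) < a" and "\<And>i. i \<in> I \<Longrightarrow> \<bar>X i \<omega>\<bar> \<le> s * (K * N)"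
      by auto
    then have "(\<Sum>i\<in>I. \<bar>X i \<omega>\<bar>) < a"
      by (simp add: Y_def truncated_abs_eq_abs cong: sum.cong)
    with * show False by simp
  qed
  then have "prob {\<omega> \<in> space M. (\<Sum>i\<in>I. \<bar>X i \<omega>\<bar>) \<ge> a}
    \<le> prob ({\<omega> \<in> space M. (\<Sum>i\<in>I. Y i \<omega>) \<ge> a} \<union> (\<Union>i\<in>I. {\<omega> \<in> space M. \<bar>X i \<omega>\<bar> > s * (K * N)}))"
    using I by (intro finite_measure_mono sets.Un sets.finite_UN) measurable
  also have "\<dots> \<le> prob {\<omega> \<in> space M. (\<Sum>i\<in>I. Y i \<omega>) \<ge> a} + prob (\<Union>i\<in>I. {\<omega> \<in> space M. \<bar>X i \<omega>\<bar> > s * (K * N)})"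
    using I by (intro measure_Un_le sets.finite_UN) measurable
  finally show ?thesis
    using 1 2 by (simp add: a_def)
qed

section \<open>The Cauchy sketch\<close>

text \<open>In the analytic part, vectors are functions of which only the values below
  \<open>D\<close> are read. The type \<open>real vec\<close> and its carriers return only in the
  translation of subspaces and distances.\<close>

definition norm1 :: "nat \<Rightarrow> (nat \<Rightarrow> real) \<Rightarrow> real" where
  "norm1 D x = (\<Sum>j<D. \<bar>x j\<bar>)"

definition row_prod :: "nat \<Rightarrow> (nat \<times> nat \<Rightarrow> real) \<Rightarrow> nat \<Rightarrow> (nat \<Rightarrow> real) \<Rightarrow> real" where
  "row_prod D \<omega> i x = (\<Sum>j<D. \<omega> (i, j) * x j)"

definition sketch_norm :: "nat \<Rightarrow> nat \<Rightarrow> (nat \<times> nat \<Rightarrow> real) \<Rightarrow> (nat \<Rightarrow> real) \<Rightarrow> real" where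
  "sketch_norm d D \<omega> x = (\<Sum>i<d. \<bar>row_prod D \<omega> i x\<bar>)"

interpretation cauchy_matrix: prob_space "cauchy_matrix_law d D" for d D
  by (rule prob_space_cauchy_matrix_law)

lemma sets_std_cauchy [measurable_cong]: "sets std_cauchy = sets borel"
  by (simp add: std_cauchy_def)

lemma measurable_cauchy_matrix_entry [measurable]:
  assumes "i < d" "j < D"
  shows "(\<lambda>\<omega>. \<omega> (i, j)) \<in> borel_measurable (cauchy_matrix_law d D)"
proof -
  have "(\<lambda>\<omega>. \<omega> (i, j)) \<in> measurable (cauchy_matrix_law d D) std_cauchy"
    unfolding cauchy_matrix_law_def using assms by (intro measurable_component_singleton) auto
  also have "measurable (cauchy_matrix_law d D) std_cauchy = borel_measurable (cauchy_matrix_law d D)"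
    by (intro measurable_cong_sets refl sets_std_cauchy)
  finally show ?thesis .
qed

lemma measurable_row_prod [measurable]:
  "i < d \<Longrightarrow> (\<lambda>\<omega>. row_prod D \<omega> i x) \<in> borel_measurable (cauchy_matrix_law d D)"
  unfolding row_prod_def by measurable

lemma measurable_sketch_norm [measurable]:
  "(\<lambda>\<omega>. sketch_norm d D \<omega> x) \<in> borel_measurable (cauchy_matrix_law d D)"
  unfolding sketch_norm_def by measurable

lemma std_cauchy_eq: "std_cauchy = density lborel (cauchy_scale_density 1)"
  by (simp add: std_cauchy_def cauchy_density_def[abs_def] cauchy_scale_density_def[abs_def])

lemma distributed_cauchy_matrix_entry:
  assumes "i < d" "j < D"
  shows "distributed (cauchy_matrix_law d D) lborel (\<lambda>\<omega>. \<omega> (i, j)) (cauchy_scale_density 1)"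
proof -
  have "distr (cauchy_matrix_law d D) std_cauchy (\<lambda>\<omega>. \<omega> (i, j)) = std_cauchy"
    unfolding cauchy_matrix_law_def using assms by (intro distr_PiM_component prob_space_std_cauchy) auto
  also have "distr (cauchy_matrix_law d D) std_cauchy (\<lambda>\<omega>. \<omega> (i, j))
      = distr (cauchy_matrix_law d D) lborel (\<lambda>\<omega>. \<omega> (i, j))"
    by (intro distr_cong refl) (simp add: sets_std_cauchy)
  finally show ?thesis
    using measurable_cauchy_matrix_entry[OF assms] by (simp add: distributed_def std_cauchy_eq)
qed

lemma indep_cauchy_matrix_entries:
  "cauchy_matrix.indep_vars d D (\<lambda>_. borel) (\<lambda>ij \<omega>. \<omega> ij) ({..<d} \<times> {..<D})"
proof (cases "{..<d} \<times> {..<D} = {}")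
  \<comment> \<open>The criterion for independence by a product law requires a nonempty index set,
    so matrices without entries are handled directly.\<close>
  case True
  then show ?thesis
    unfolding cauchy_matrix.indep_vars_def cauchy_matrix.indep_sets_def by (simp add: True)
next
  case False
  let ?I = "{..<d} \<times> {..<D}" and ?M = "cauchy_matrix_law d D"
  have "cauchy_matrix.indep_vars d D (\<lambda>_. std_cauchy) (\<lambda>ij \<omega>. \<omega> ij) ?I"
  proof (subst cauchy_matrix.indep_vars_iff_distr_eq_PiM'[OF False])
    show "(\<lambda>\<omega>. \<omega> ij) \<in> measurable ?M std_cauchy" if "ij \<in> ?I" for ij
      unfolding cauchy_matrix_law_def using that by (rule measurable_component_singleton)
    have "distr ?M (\<Pi>\<^sub>M i\<in>?I. std_cauchy) (\<lambda>x. \<lambda>i\<in>?I. x i) = distr ?M ?M (\<lambda>x. x)"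
      by (rule distr_cong) (auto simp: cauchy_matrix_law_def space_PiM PiE_def extensional_restrict)
    also have "\<dots> = ?M"
      by (simp add: distr_id2)
    also have "\<dots> = (\<Pi>\<^sub>M i\<in>?I. distr ?M std_cauchy (\<lambda>x. x i))"
      unfolding cauchy_matrix_law_def
      by (intro PiM_cong refl distr_PiM_component[symmetric] prob_space_std_cauchy)
    finally show "distr ?M (\<Pi>\<^sub>M i\<in>?I. std_cauchy) (\<lambda>x. \<lambda>i\<in>?I. x i)
      = (\<Pi>\<^sub>M i\<in>?I. distr ?M std_cauchy (\<lambda>x. x i))" .
  qed
  \<comment> \<open>Composition with the identity replaces the target \<open>std_cauchy\<close> by
    \<open>borel\<close>, which has the same measurable sets.\<close>
  from cauchy_matrix.indep_vars_compose2[OF this, of "\<lambda>_ x. x" "\<lambda>_. borel"]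
  show ?thesis
    by (simp add: measurable_def sets_std_cauchy sets_eq_imp_space_eq[OF sets_std_cauchy])
qed

lemma distributed_row_prod:
  assumes i: "i < d" and x: "norm1 D x > 0"
  shows "distributed (cauchy_matrix_law d D) lborel (\<lambda>\<omega>. row_prod D \<omega> i x) (cauchy_scale_density (norm1 D x))"
proof -
  \<comment> \<open>Zero coordinates are removed because the constant 0 has no density and the sum
    rule asks for positive scales.\<close>
  define J where "J = {j. j < D \<and> x j \<noteq> 0}"
  have J: "finite J" "J \<subseteq> {..<D}" "\<And>j. j \<in> J \<Longrightarrow> x j \<noteq> 0" by (auto simp: J_def)
  have norm: "norm1 D x = (\<Sum>j\<in>J. \<bar>x j\<bar>)"
    unfolding norm1_def J_def by (intro sum.mono_neutral_right) auto
  then have "J \<noteq> {}" using x by auto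
  have row: "row_prod D \<omega> i x = (\<Sum>j\<in>J. \<omega> (i, j) * x j)" for \<omega>
    unfolding row_prod_def J_def by (intro sum.mono_neutral_right) auto
  have "cauchy_matrix.indep_vars d D (\<lambda>_. borel) (\<lambda>ij \<omega>. \<omega> ij) ((\<lambda>j. (i, j)) ` J)"
    using i J by (intro cauchy_matrix.indep_vars_subset[OF indep_cauchy_matrix_entries]) auto
  from cauchy_matrix.indep_vars_compose2[OF this, of "\<lambda>ij u. u * x (snd ij)" "\<lambda>_. borel"]
  have indep: "cauchy_matrix.indep_vars d D (\<lambda>_. borel) (\<lambda>ij \<omega>. \<omega> ij * x (snd ij)) ((\<lambda>j. (i, j)) ` J)"
    by simp
  have "distributed (cauchy_matrix_law d D) lborel (\<lambda>\<omega>. \<omega> (i, j) * x j) (cauchy_scale_density \<bar>x j\<bar>)" if "j \<in> J" for j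
  proof -
    have xj: "x j \<noteq> 0" and j: "j < D" using that J by auto
    have "distributed (cauchy_matrix_law d D) lborel (\<lambda>\<omega>. 0 + x j * \<omega> (i, j))
        (\<lambda>u. ennreal (cauchy_scale_density 1 ((u - 0) / x j)) / ennreal \<bar>x j\<bar>)"
      by (rule cauchy_matrix.distributed_affine[OF distributed_cauchy_matrix_entry[OF i j] xj])
    moreover have "ennreal (cauchy_scale_density 1 ((u - 0) / x j)) / ennreal \<bar>x j\<bar>
        = ennreal (cauchy_scale_density \<bar>x j\<bar> u)" for u
    proof -
      have "1 / (pi * (1 + (u / x j)\<^sup>2)) / \<bar>x j\<bar> = \<bar>x j\<bar> / (pi * ((x j)\<^sup>2 + u\<^sup>2))"
      proof -
        have "1 + (u / x j)\<^sup>2 = ((x j)\<^sup>2 + u\<^sup>2) / (\<bar>x j\<bar> * \<bar>x j\<bar>)"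
          using xj by (simp add: power_divide add_divide_distrib power2_eq_square)
        then show ?thesis using xj by (cases "x j > 0") simp_all
      qed
      then show ?thesis
        using xj by (simp add: divide_ennreal cauchy_scale_density_def)
    qed
    ultimately show ?thesis
      by (simp add: mult.commute)
  qed
  then have "distributed (cauchy_matrix_law d D) lborel (\<lambda>\<omega>. \<Sum>ij\<in>(\<lambda>j. (i, j)) ` J. \<omega> ij * x (snd ij))
      (cauchy_scale_density (\<Sum>ij\<in>(\<lambda>j. (i, j)) ` J. \<bar>x (snd ij)\<bar>))"
    using J \<open>J \<noteq> {}\<close> by (intro cauchy_matrix.sum_indep_cauchy indep) auto
  then show ?thesis
    unfolding row norm by (simp add: sum.reindex inj_on_def)
qed

text \<open>Different rows read disjoint blocks of independent entries.\<close>

lemma indep_rows: "cauchy_matrix.indep_vars d D (\<lambda>_. borel) (\<lambda>i \<omega>. row_prod D \<omega> i x) {..<d}"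
proof -
  have "cauchy_matrix.indep_vars d D (\<lambda>i. PiM ({i} \<times> {..<D}) (\<lambda>_. borel))
      (\<lambda>i \<omega>. restrict (\<lambda>ij. \<omega> ij) ({i} \<times> {..<D})) {..<d}"
    by (intro cauchy_matrix.indep_vars_restrict[OF indep_cauchy_matrix_entries])
      (auto simp: disjoint_family_on_def)
  from cauchy_matrix.indep_vars_compose2[OF this, of "\<lambda>i \<omega>. row_prod D \<omega> i x" "\<lambda>_. borel"]
  have "cauchy_matrix.indep_vars d D (\<lambda>_. borel) (\<lambda>i \<omega>. row_prod D (restrict (\<lambda>ij. \<omega> ij) ({i} \<times> {..<D})) i x) {..<d}"
    unfolding row_prod_def by (auto intro!: borel_measurable_sum borel_measurable_times measurable_component_singleton)
  then show ?thesis
    by (simp add: row_prod_def)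
qed

lemma sketch_norm_lower_tail:
  assumes x: "norm1 D x > 0" and B: "B > 0" and e: "0 < e" "e < 1"
  shows "cauchy_matrix.prob d D {\<omega> \<in> space (cauchy_matrix_law d D).
      sketch_norm d D \<omega> x \<le> (1 - e) * d * (ln (1 + B\<^sup>2) / pi) * norm1 D x}
    \<le> exp (- (e\<^sup>2 / 2 * d * (ln (1 + B\<^sup>2) / pi) / B))"
  using cauchy_matrix.sum_abs_cauchy_lower_tail[OF _ indep_rows distributed_row_prod[OF _ x] x B e]
  unfolding sketch_norm_def by simp

lemma sketch_norm_upper_tail:
  assumes x: "norm1 D x > 0" and d: "d > 0" and K: "K > 0" and e: "0 < e"
  shows "cauchy_matrix.prob d D {\<omega> \<in> space (cauchy_matrix_law d D).
      sketch_norm d D \<omega> x \<ge> (1 + e) * d * (ln (1 + (K * d)\<^sup>2) / pi) * norm1 D x}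
    \<le> 1 / (1 + e) + 1 / K"
proof -
  have "{..<d} \<noteq> {}" using d by auto
  from cauchy_matrix.sum_abs_cauchy_upper_tail[OF _ this distributed_row_prod[OF _ x] x K e]
  show ?thesis unfolding sketch_norm_def by simp
qed

lemma row_prod_tail:
  assumes x: "norm1 D x \<le> 1" and i: "i < d" and t: "t > 0"
  shows "cauchy_matrix.prob d D {\<omega> \<in> space (cauchy_matrix_law d D). \<bar>row_prod D \<omega> i x\<bar> > t} \<le> 1 / t"
proof (cases "norm1 D x > 0")
  case True
  have "cauchy_matrix.prob d D {\<omega> \<in> space (cauchy_matrix_law d D). \<bar>row_prod D \<omega> i x\<bar> > t} \<le> norm1 D x / t"
    by (rule cauchy_matrix.cauchy_tail_le[OF distributed_row_prod[OF i True] True t])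
  also have "\<dots> \<le> 1 / t" using x t by (intro divide_right_mono) auto
  finally show ?thesis .
next
  case False
  then have "norm1 D x = 0"
    by (simp add: norm1_def order.antisym sum_nonneg)
  then have "\<forall>j<D. x j = 0"
    by (simp add: norm1_def sum_nonneg_eq_0_iff)
  then have "row_prod D \<omega> i x = 0" for \<omega>
    by (simp add: row_prod_def)
  then show ?thesis
    using t by simp
qed

section \<open>Well-conditioned bases\<close>

definition lin_comb :: "nat \<Rightarrow> (nat \<Rightarrow> real) \<Rightarrow> (nat \<Rightarrow> nat \<Rightarrow> real) \<Rightarrow> nat \<Rightarrow> real" where
  "lin_comb k a w j = (\<Sum>l<k. a l * w l j)"

lemma norm1_nonneg: "norm1 D x \<ge> 0"
  by (simp add: norm1_def sum_nonneg)

lemma norm1_ge_component: "j < D \<Longrightarrow> \<bar>x j\<bar> \<le> norm1 D x"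
  unfolding norm1_def by (rule member_le_sum) auto

lemma norm1_scale: "norm1 D (\<lambda>j. r * x j) = \<bar>r\<bar> * norm1 D x"
  by (simp add: norm1_def abs_mult sum_distrib_left)

lemma norm1_cong: "(\<And>j. j < D \<Longrightarrow> x j = y j) \<Longrightarrow> norm1 D x = norm1 D y"
  by (simp add: norm1_def)

lemma lin_comb_scale: "lin_comb k (\<lambda>l. r * a l) w j = r * lin_comb k a w j"
  by (simp add: lin_comb_def sum_distrib_left mult.assoc)

lemma lin_comb_unit: "l < k \<Longrightarrow> lin_comb k (\<lambda>i. if i = l then 1 else 0) w = w l"
  by (rule ext) (simp add: lin_comb_def if_distrib[of "\<lambda>x. x * _"] cong: if_cong)

text \<open>Gaussian elimination with pivot positions \<open>p\<close>. Since \<open>b\<close> is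
  dual to the pivots, the coefficients of a vector of the span are its own values there and are
  bounded by its norm. The family \<open>w\<close> may be dependent, hence
  \<open>m \<le> k\<close>.\<close>

lemma reduced_basis_exists:
  obtains m :: nat and p :: "nat \<Rightarrow> nat" and b :: "nat \<Rightarrow> nat \<Rightarrow> real"
  where "m \<le> k" "\<And>l. l < m \<Longrightarrow> p l < D"
    "\<And>l l'. l < m \<Longrightarrow> l' < m \<Longrightarrow> b l (p l') = (if l = l' then 1 else 0)"
    "\<And>a. \<exists>c. \<forall>j<D. lin_comb k a w j = lin_comb m c b j"
proof -
  have "\<exists>m p b. m \<le> k \<and> (\<forall>l<m. p l < D) \<and> (\<forall>l<m. \<forall>l'<m. b l (p l') = (if l = l' then 1 else 0)) \<and>
      (\<forall>a. \<exists>c. \<forall>j<D. lin_comb k a w j = lin_comb m c b j)" (is "\<exists>m p b. ?P k m p b")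
  proof (induction k)
    case 0
    show ?case
      by (intro exI[of _ 0]) (auto simp: lin_comb_def)
  next
    case (Suc k)
    then obtain m p b where IH: "m \<le> k" "\<And>l. l < m \<Longrightarrow> p l < D"
      "\<And>l l'. l < m \<Longrightarrow> l' < m \<Longrightarrow> b l (p l') = (if l = l' then 1 else 0)"
      "\<And>a. \<exists>c. \<forall>j<D. lin_comb k a w j = lin_comb m c b j"
      by blast
    \<comment> \<open>The new vector after clearing its values at the existing pivots.\<close>
    define u where "u j = w k j - (\<Sum>l<m. w k (p l) * b l j)" for j
    have u0: "u (p l) = 0" if "l < m" for l
    proof -
      have "(\<Sum>l'<m. w k (p l') * b l' (p l)) = (\<Sum>l'<m. if l' = l then w k (p l') else 0)"
        using that IH(3) by (intro sum.cong) auto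
      then show ?thesis using that by (simp add: u_def)
    qed
    have expand: "\<exists>e. \<forall>j<D. lin_comb (Suc k) a w j = lin_comb m e b j + a k * u j" for a
    proof -
      obtain c where c: "\<forall>j<D. lin_comb k a w j = lin_comb m c b j"
        using IH(4) by blast
      show ?thesis
      proof (intro exI[of _ "\<lambda>l. c l + a k * w k (p l)"] allI impI)
        fix j assume "j < D"
        then have "lin_comb (Suc k) a w j = lin_comb m c b j + a k * w k j"
          using c by (simp add: lin_comb_def)
        also have "w k j = u j + (\<Sum>l<m. w k (p l) * b l j)"
          by (simp add: u_def)
        finally show "lin_comb (Suc k) a w j = lin_comb m (\<lambda>l. c l + a k * w k (p l)) b j + a k * u j"
          by (simp add: lin_comb_def algebra_simps sum.distrib sum_distrib_left)
      qed
    qed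
    show ?case
    proof (cases "\<forall>j<D. u j = 0")
      case True
      have "\<exists>c. \<forall>j<D. lin_comb (Suc k) a w j = lin_comb m c b j" for a
        using expand[of a] True by auto
      then have "?P (Suc k) m p b"
        using IH by auto
      then show ?thesis by blast
    next
      case False
      then obtain q where q: "q < D" "u q \<noteq> 0" by blast
      \<comment> \<open>The residual is normalized at its pivot \<open>q\<close>, and the value at
        \<open>q\<close> is cleared from the older basis vectors.\<close>
      define b' where "b' l = (if l = m then (\<lambda>j. u j / u q) else (\<lambda>j. b l j - b l q * (u j / u q)))" for l
      define p' where "p' = p(m := q)"
      have dual: "b' l (p' l') = (if l = l' then 1 else 0)" if "l < Suc m" "l' < Suc m" for l l'
        using that q u0 IH(3) by (auto simp: b'_def p'_def less_Suc_eq)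
      have span: "\<exists>c. \<forall>j<D. lin_comb (Suc k) a w j = lin_comb (Suc m) c b' j" for a
      proof -
        obtain e where e: "\<forall>j<D. lin_comb (Suc k) a w j = lin_comb m e b j + a k * u j"
          using expand by blast
        \<comment> \<open>By duality the coefficient of the new basis vector is the value of the
          whole combination at \<open>q\<close>.\<close>
        define s where "s = (\<Sum>l<m. e l * b l q) + a k * u q"
        show ?thesis
        proof (intro exI[of _ "e(m := s)"] allI impI)
          fix j assume "j < D"
          have "lin_comb (Suc m) (e(m := s)) b' j
              = (\<Sum>l<m. e l * (b l j - b l q * (u j / u q))) + s * (u j / u q)"
            by (simp add: lin_comb_def b'_def)
          also have "(\<Sum>l<m. e l * (b l j - b l q * (u j / u q)))
              = lin_comb m e b j - (\<Sum>l<m. e l * b l q) * (u j / u q)"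
            by (simp add: lin_comb_def right_diff_distrib sum_subtractf sum_distrib_right mult.assoc sum_divide_distrib)
          also have "lin_comb m e b j - (\<Sum>l<m. e l * b l q) * (u j / u q) + s * (u j / u q)
              = lin_comb m e b j + a k * u j"
            using q by (simp add: s_def field_simps)
          finally show "lin_comb (Suc k) a w j = lin_comb (Suc m) (e(m := s)) b' j"
            using e[rule_format, OF \<open>j < D\<close>] by (simp only:)
        qed
      qed
      have "?P (Suc k) (Suc m) p' b'"
        using IH(1,2) q dual span by (auto simp: p'_def less_Suc_eq)
      then show ?thesis by blast
    qed
  qed
  then show ?thesis using that by blast
qed

text \<open>A basis whose coefficient determinant is within a factor of 2 of the supremum over the unit
  ball is almost an Auerbach basis: by Cramer's rule each coordinate of a unit vector is a quotient
  of two such determinants.\<close>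
lemma near_auerbach_basis_exists:
  fixes w :: "nat \<Rightarrow> nat \<Rightarrow> real"
  obtains m :: nat and y :: "nat \<Rightarrow> nat \<Rightarrow> real"
  where "m \<le> k" "\<And>l. l < m \<Longrightarrow> norm1 D (y l) \<le> 1"
    "\<And>a. \<exists>g. (\<forall>j<D. lin_comb k a w j = lin_comb m g y j) \<and>
       (\<forall>l<m. \<bar>g l\<bar> \<le> 2 * norm1 D (lin_comb k a w))"
proof -
  obtain m p b where mk: "m \<le> k" and p: "\<And>l. l < m \<Longrightarrow> p l < D"
    and dual: "\<And>l l'. l < m \<Longrightarrow> l' < m \<Longrightarrow> b l (p l') = (if l = l' then 1 else 0)"
    and span: "\<And>a. \<exists>c. \<forall>j<D. lin_comb k a w j = lin_comb m c b j"
    using reduced_basis_exists[of k D w] by blast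
  have coord: "lin_comb m c b (p l) = c l" if "l < m" for c l
  proof -
    have "lin_comb m c b (p l) = (\<Sum>l'<m. if l' = l then c l' else 0)"
      unfolding lin_comb_def using that dual by (intro sum.cong) auto
    then show ?thesis using that by simp
  qed
  have coord_le: "\<bar>c l\<bar> \<le> norm1 D (lin_comb m c b)" if "l < m" for c l
    using norm1_ge_component[OF p[OF that], of "lin_comb m c b"] coord[OF that] by simp
  \<comment> \<open>Column \<open>l\<close> of \<open>A C\<close> holds the coefficients of the
    candidate vector \<open>l\<close> in the reduced basis; \<open>adm C\<close> says that all
    candidates lie in the unit ball.\<close>
  define A where "A C = mat m m (\<lambda>(i, l). C l i)" for C :: "nat \<Rightarrow> nat \<Rightarrow> real"
  have A: "A C \<in> carrier_mat m m" for C by (simp add: A_def)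
  define adm where "adm C \<longleftrightarrow> (\<forall>l<m. norm1 D (lin_comb m (C l) b) \<le> 1)" for C
  define Q where "Q = {\<bar>Determinant.det (A C)\<bar> |C. adm C}"
  \<comment> \<open>Admissible coefficients are at most 1 in absolute value, so each term of the
    Leibniz formula is at most 1 and the determinant is bounded by the number of
    permutations.\<close>
  have bdd: "bdd_above Q"
  proof (rule bdd_aboveI)
    fix q assume "q \<in> Q"
    then obtain C where C: "adm C" "q = \<bar>Determinant.det (A C)\<bar>" by (auto simp: Q_def)
    have entry: "\<bar>C l i\<bar> \<le> 1" if "l < m" "i < m" for l i
      using coord_le[OF that(2), of "C l"] C(1) that(1) by (force simp: adm_def)
    have "q \<le> (\<Sum>\<pi> | \<pi> permutes {0..<m}. \<bar>signof \<pi> * (\<Prod>i = 0..<m. A C $$ (i, \<pi> i))\<bar>)"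
      unfolding C(2) det_def'[OF A] by (rule sum_abs)
    also have "\<dots> \<le> (\<Sum>\<pi> | \<pi> permutes {0..<m}. 1)"
    proof (rule sum_mono)
      fix \<pi> assume "\<pi> \<in> {\<pi>. \<pi> permutes {0..<m}}"
      then have \<pi>: "\<pi> permutes {0..<m}" by simp
      have "\<bar>\<Prod>i = 0..<m. A C $$ (i, \<pi> i)\<bar> \<le> 1"
        unfolding abs_prod
      proof (rule prod_le_1)
        fix i assume "i \<in> {0..<m}"
        then have "i < m" "\<pi> i < m" using permutes_in_image[OF \<pi>, of i] by auto
        then show "0 \<le> \<bar>A C $$ (i, \<pi> i)\<bar> \<and> \<bar>A C $$ (i, \<pi> i)\<bar> \<le> 1"
          using entry by (simp add: A_def)
      qed
      then show "\<bar>signof \<pi> * (\<Prod>i = 0..<m. A C $$ (i, \<pi> i))\<bar> \<le> 1"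
        by (simp add: abs_mult sign_def)
    qed
    finally show "q \<le> (\<Sum>\<pi> | \<pi> permutes {0..<m}. 1)" .
  qed
  \<comment> \<open>A sufficiently small multiple of the reduced basis itself is admissible. A
    positive supremum is what allows some determinant to exceed half of it.\<close>
  have "\<exists>q\<in>Q. q > 0"
  proof -
    define N where "N = 1 + (\<Sum>l<m. norm1 D (b l))"
    have N: "N > 0" "\<And>l. l < m \<Longrightarrow> norm1 D (b l) \<le> N"
    proof -
      show "N > 0" unfolding N_def by (simp add: add_pos_nonneg sum_nonneg norm1_nonneg)
      fix l assume "l < m"
      then have "norm1 D (b l) \<le> (\<Sum>l<m. norm1 D (b l))"
        by (intro member_le_sum) (auto simp: norm1_nonneg)
      then show "norm1 D (b l) \<le> N" by (simp add: N_def)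
    qed
    define C where "C l i = 1 / N * (if i = l then 1 else 0)" for l i :: nat
    have "norm1 D (lin_comb m (C l) b) = \<bar>1 / N\<bar> * norm1 D (b l)" if "l < m" for l
      unfolding C_def lin_comb_scale norm1_scale lin_comb_unit[OF that] ..
    then have "adm C"
      unfolding adm_def using N by simp
    moreover
    have "A C = (1 / N) \<cdot>\<^sub>m 1\<^sub>m m"
      by (rule eq_matI) (auto simp: A_def C_def)
    then have "Determinant.det (A C) = (1 / N) ^ m" by simp
    ultimately show ?thesis
      using N by (auto simp: Q_def intro!: exI[of _ C])
  qed
  then have "Sup Q > 0"
    using bdd by (meson cSup_upper less_le_trans)
  \<comment> \<open>Accepting half of the supremum avoids a compactness argument for a maximizer;
    the price is the bound 2 instead of 1 on the coordinates.\<close>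
  then have "Sup Q / 2 < Sup Q" "Q \<noteq> {}"
    using \<open>\<exists>q\<in>Q. q > 0\<close> by auto
  then obtain q where "q \<in> Q" "Sup Q / 2 < q"
    using less_cSup_iff[OF _ bdd] by blast
  then obtain C where C: "adm C" and C_max: "Sup Q < 2 * \<bar>Determinant.det (A C)\<bar>"
    by (auto simp: Q_def)
  have det_pos: "\<bar>Determinant.det (A C)\<bar> > 0"
    using C_max \<open>Sup Q > 0\<close> by simp
  define y where "y l = lin_comb m (C l) b" for l
  have bounded: "\<exists>g. (\<forall>j<D. lin_comb m c b j = lin_comb m g y j) \<and> (\<forall>l<m. \<bar>g l\<bar> \<le> 2)"
    if c: "norm1 D (lin_comb m c b) \<le> 1" for c
  proof -
    define v where "v = vec m c"
    \<comment> \<open>The coordinates of the given vector in the basis \<open>y\<close>, with the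
      inverse matrix written through the adjugate.\<close>
    define x where "x = (1 / Determinant.det (A C)) \<cdot>\<^sub>v (adj_mat (A C) *\<^sub>v v)"
    have v: "v \<in> carrier_vec m" by (simp add: v_def)
    have x: "x \<in> carrier_vec m"
      unfolding x_def by (intro smult_carrier_vec[THEN iffD2] mult_mat_vec_carrier[OF adj_mat(1)[OF A] v])
    have "A C *\<^sub>v x = (1 / Determinant.det (A C)) \<cdot>\<^sub>v (A C *\<^sub>v (adj_mat (A C) *\<^sub>v v))"
      unfolding x_def by (intro mult_mat_vec[OF A] mult_mat_vec_carrier[OF adj_mat(1)[OF A] v])
    also have "A C *\<^sub>v (adj_mat (A C) *\<^sub>v v) = (A C * adj_mat (A C)) *\<^sub>v v"
      by (rule assoc_mult_mat_vec[OF A adj_mat(1)[OF A] v, symmetric])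
    also have "\<dots> = Determinant.det (A C) \<cdot>\<^sub>v v"
      unfolding adj_mat(2)[OF A] using v by auto
    finally have Ax: "A C *\<^sub>v x = v"
      using det_pos v by (simp add: smult_smult_assoc)
    have "\<bar>x $ l\<bar> \<le> 2" if l: "l < m" for l
    proof -
      \<comment> \<open>The numerator in Cramer's rule is again the determinant of an admissible
        family, since the column inserted belongs to a vector of the unit ball.\<close>
      have "replace_col (A C) v l = A (C(l := c))"
        by (rule eq_matI) (auto simp: replace_col_def A_def v_def)
      moreover have "adm (C(l := c))"
        using C c by (auto simp: adm_def)
      ultimately have "\<bar>Determinant.det (replace_col (A C) v l)\<bar> \<in> Q"
        by (auto simp: Q_def)
      then have "\<bar>Determinant.det (replace_col (A C) v l)\<bar> \<le> Sup Q"
        using bdd by (rule cSup_upper)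
      also have "Determinant.det (replace_col (A C) v l) = x $ l * Determinant.det (A C)"
        using cramer_lemma_mat[OF A[of C] x l] unfolding Ax .
      finally have "\<bar>x $ l\<bar> * \<bar>Determinant.det (A C)\<bar> \<le> 2 * \<bar>Determinant.det (A C)\<bar>"
        using C_max by (simp add: abs_mult)
      then show ?thesis using det_pos by simp
    qed
    moreover have "lin_comb m c b j = lin_comb m (\<lambda>l. x $ l) y j" for j
    proof -
      have "c i = (\<Sum>l<m. x $ l * C l i)" if "i < m" for i
      proof -
        have "c i = (A C *\<^sub>v x) $ i" using that by (simp add: Ax v_def)
        also have "\<dots> = (\<Sum>l<m. x $ l * C l i)"
          using that x by (simp add: A_def scalar_prod_def atLeast0LessThan mult.commute)
        finally show ?thesis .
      qed
      then have "lin_comb m c b j = (\<Sum>i<m. (\<Sum>l<m. x $ l * C l i) * b i j)"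
        by (simp add: lin_comb_def)
      also have "\<dots> = (\<Sum>l<m. \<Sum>i<m. x $ l * C l i * b i j)"
        by (simp add: sum_distrib_right) (rule sum.swap)
      also have "\<dots> = lin_comb m (\<lambda>l. x $ l) y j"
        by (simp add: lin_comb_def y_def sum_distrib_left mult.assoc)
      finally show ?thesis .
    qed
    ultimately show ?thesis by (intro exI[of _ "\<lambda>l. x $ l"]) auto
  qed
  show ?thesis
  proof (rule that[OF mk, of y])
    show "norm1 D (y l) \<le> 1" if "l < m" for l
      using C that by (simp add: adm_def y_def)
    fix a
    obtain c where c: "\<forall>j<D. lin_comb k a w j = lin_comb m c b j"
      using span by blast
    define N where "N = norm1 D (lin_comb k a w)"
    have N: "N = norm1 D (lin_comb m c b)"
      unfolding N_def using c by (intro norm1_cong) auto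
    show "\<exists>g. (\<forall>j<D. lin_comb k a w j = lin_comb m g y j) \<and> (\<forall>l<m. \<bar>g l\<bar> \<le> 2 * norm1 D (lin_comb k a w))"
    proof (cases "N = 0")
      case True
      have "lin_comb k a w j = 0" if "j < D" for j
        using norm1_ge_component[OF that, of "lin_comb k a w"] True by (simp add: N_def)
      then show ?thesis
        by (intro exI[of _ "\<lambda>_. 0"]) (auto simp: lin_comb_def[of m] norm1_nonneg)
    next
      case False
      then have "N > 0" using norm1_nonneg[of D "lin_comb k a w"] by (simp add: N_def)
      have "norm1 D (lin_comb m (\<lambda>l. 1 / N * c l) b) = \<bar>1 / N\<bar> * N"
        unfolding lin_comb_scale norm1_scale N[symmetric] ..
      then have "norm1 D (lin_comb m (\<lambda>l. 1 / N * c l) b) = 1"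
        using \<open>N > 0\<close> by simp
      then obtain g where g: "\<forall>j<D. lin_comb m (\<lambda>l. 1 / N * c l) b j = lin_comb m g y j" "\<forall>l<m. \<bar>g l\<bar> \<le> 2"
        using bounded[of "\<lambda>l. 1 / N * c l"] by (metis order_refl)
      have "lin_comb k a w j = lin_comb m (\<lambda>l. N * g l) y j" if "j < D" for j
        using g(1) c that \<open>N > 0\<close> by (simp only: lin_comb_scale) (auto simp: field_simps)
      moreover have "\<bar>N * g l\<bar> \<le> 2 * N" if "l < m" for l
        using g(2) that \<open>N > 0\<close> by (simp add: abs_mult)
      ultimately show ?thesis
        by (intro exI[of _ "\<lambda>l. N * g l"]) (auto simp: N_def)
    qed
  qed
qed

section \<open>Subspaces, measurability and nets\<close>

text \<open>Independence inside \<open>S\<close> is independence in \<open>V\<close>, so independent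
  subsets of \<open>S\<close> have bounded size. A maximal one exists and generates
  \<open>S\<close>.\<close>

lemma (in vectorspace) fin_dim_subspace:
  assumes fd: "fin_dim" and S: "VectorSpace.subspace K S V"
  shows "vectorspace.fin_dim K (vs S)"
proof -
  interpret W: vectorspace K "vs S" by (rule subspace_is_vs[OF S])
  have sub: "submodule K S V" using S by simp
  have SV: "S \<subseteq> carrier V" using sub by (simp add: submodule_def)
  have card: "finite A \<and> card A \<le> dim" if A: "A \<subseteq> S \<and> W.lin_indpt A" for A
  proof -
    have "lin_indpt A" using span_li_not_depend(2)[OF _ sub, of A] A by simp
    then show ?thesis using li_le_dim[OF fd, of A] A SV by auto
  qed
  have "W.lin_indpt {}" by (simp add: W.lin_dep_def)
  then obtain A where A: "finite A" "maximal A (\<lambda>A. A \<subseteq> S \<and> W.lin_indpt A)"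
    using maximal_exists[of "\<lambda>A. A \<subseteq> S \<and> W.lin_indpt A" dim "{}"] card by blast
  then have "W.gen_set A" by (intro W.max_li_is_gen) simp
  moreover have "A \<subseteq> S" using A(2) by (simp add: maximal_def)
  ultimately show ?thesis using A(1) by (auto simp: W.fin_dim_def)
qed

text \<open>The passage from abstract subspaces to coefficient functions: linear combinations
  indexed by the vectors of a basis are reindexed by the numbers below \<open>r\<close>.\<close>

lemma linear_subspace_of_dim_eq_range:
  assumes "linear_subspace_of_dim D r S"
  obtains w where "S = range (\<lambda>a. vec D (lin_comb r a w))"
proof -
  interpret V: vec_space "TYPE(real)" D .
  have S: "VectorSpace.subspace class_ring S V.V" and dim: "vectorspace.dim class_ring (V.vs S) = r"
    using assms by (auto simp: linear_subspace_of_dim_def)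
  interpret W: vectorspace class_ring "V.vs S" by (rule V.subspace_is_vs[OF S])
  have sub: "submodule class_ring S V.V" using S by simp
  have SV: "S \<subseteq> carrier_vec D" using sub by (simp add: submodule_def)
  have "W.fin_dim" by (rule V.fin_dim_subspace[OF V.fin_dim S])
  then obtain \<beta> where \<beta>: "finite \<beta>" "W.basis \<beta>"
    using W.finite_basis_exists by blast
  have card: "card \<beta> = r" using W.dim_basis[OF \<beta>] dim by simp
  have \<beta>S: "\<beta> \<subseteq> S" using \<beta>(2) by (simp add: W.basis_def)
  have "W.span \<beta> = S" using \<beta>(2) by (simp add: W.basis_def)
  then have "V.span \<beta> = S" using V.span_li_not_depend(1)[OF \<beta>S sub] by simp
  then have span: "S = {V.lincomb a \<beta> |a. a \<in> \<beta> \<rightarrow> UNIV}"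
    using V.finite_span[OF \<beta>(1)] \<beta>S SV by auto
  obtain h where h: "bij_betw h {..<r} \<beta>"
    using ex_bij_betw_nat_finite[OF \<beta>(1)] card by (auto simp: atLeast0LessThan)
  define w where "w l j = h l $ j" for l j
  have lincomb: "V.lincomb a \<beta> = vec D (lin_comb r (\<lambda>l. a (h l)) w)" for a
  proof (rule eq_vecI)
    have "V.lincomb a \<beta> \<in> carrier_vec D"
      using \<beta>S SV by (intro V.lincomb_closed) auto
    then show "dim_vec (V.lincomb a \<beta>) = dim_vec (vec D (lin_comb r (\<lambda>l. a (h l)) w))" by simp
    fix j assume "j < dim_vec (vec D (lin_comb r (\<lambda>l. a (h l)) w))"
    then have j: "j < D" by simp
    have "V.lincomb a \<beta> $ j = (\<Sum>x\<in>\<beta>. a x * x $ j)"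
      using \<beta>S SV by (intro V.lincomb_index[OF j]) auto
    also have "\<dots> = (\<Sum>l<r. a (h l) * h l $ j)"
      by (rule sum.reindex_bij_betw[OF h, symmetric])
    finally show "V.lincomb a \<beta> $ j = vec D (lin_comb r (\<lambda>l. a (h l)) w) $ j"
      using j by (simp add: lin_comb_def w_def)
  qed
  have "S = range (\<lambda>a. vec D (lin_comb r a w))"
  proof
    show "S \<subseteq> range (\<lambda>a. vec D (lin_comb r a w))"
      unfolding span lincomb by auto
    show "range (\<lambda>a. vec D (lin_comb r a w)) \<subseteq> S"
    proof
      fix x assume "x \<in> range (\<lambda>a. vec D (lin_comb r a w))"
      then obtain a where x: "x = vec D (lin_comb r a w)" by auto
      \<comment> \<open>The bijection \<open>h\<close> is inverted because abstract coefficients are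
        attached to the basis vectors, not to their numbers.\<close>
      define a' where "a' = (\<lambda>v. a (the_inv_into {..<r} h v))"
      have "lin_comb r (\<lambda>l. a' (h l)) w = lin_comb r a w"
        using h by (intro ext) (auto simp: lin_comb_def a'_def bij_betw_def the_inv_into_f_f intro!: sum.cong)
      then have "x = V.lincomb a' \<beta>" by (simp add: x lincomb)
      then show "x \<in> S" unfolding span by auto
    qed
  qed
  then show ?thesis by (rule that)
qed

section \<open>Seminorm rules, and distances as infima over coefficients\<close>

lemma row_prod_add: "row_prod D \<omega> i (\<lambda>j. x j + y j) = row_prod D \<omega> i x + row_prod D \<omega> i y"
  by (simp add: row_prod_def distrib_left sum.distrib)

lemma row_prod_scale: "row_prod D \<omega> i (\<lambda>j. r * x j) = r * row_prod D \<omega> i x"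
  by (simp add: row_prod_def sum_distrib_left mult.left_commute)

lemma sketch_norm_nonneg: "sketch_norm d D \<omega> x \<ge> 0"
  by (simp add: sketch_norm_def sum_nonneg)

lemma sketch_norm_cong: "(\<And>j. j < D \<Longrightarrow> x j = y j) \<Longrightarrow> sketch_norm d D \<omega> x = sketch_norm d D \<omega> y"
  by (simp add: sketch_norm_def row_prod_def)

lemma sketch_norm_add_le: "sketch_norm d D \<omega> (\<lambda>j. x j + y j) \<le> sketch_norm d D \<omega> x + sketch_norm d D \<omega> y"
  unfolding sketch_norm_def row_prod_add sum.distrib[symmetric] by (intro sum_mono abs_triangle_ineq)

lemma sketch_norm_scale: "sketch_norm d D \<omega> (\<lambda>j. r * x j) = \<bar>r\<bar> * sketch_norm d D \<omega> x"
  by (simp add: sketch_norm_def row_prod_scale abs_mult sum_distrib_left)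

lemma sketch_norm_lin_comb_le:
  "sketch_norm d D \<omega> (lin_comb m g y) \<le> (\<Sum>l<m. \<bar>g l\<bar> * sketch_norm d D \<omega> (y l))"
proof (induction m)
  case 0
  show ?case by (simp add: lin_comb_def[abs_def] sketch_norm_def row_prod_def)
next
  case (Suc m)
  have "sketch_norm d D \<omega> (lin_comb (Suc m) g y) = sketch_norm d D \<omega> (\<lambda>j. lin_comb m g y j + g m * y m j)"
    by (simp add: lin_comb_def[abs_def])
  also have "\<dots> \<le> sketch_norm d D \<omega> (lin_comb m g y) + \<bar>g m\<bar> * sketch_norm d D \<omega> (y m)"
    unfolding sketch_norm_scale[symmetric] by (rule sketch_norm_add_le)
  finally show ?case using Suc by simp
qed

lemma norm1_add_le: "norm1 D (\<lambda>j. x j + y j) \<le> norm1 D x + norm1 D y"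
  unfolding norm1_def sum.distrib[symmetric] by (intro sum_mono abs_triangle_ineq)

lemma norm1_lin_comb_le: "norm1 D (lin_comb m g y) \<le> (\<Sum>l<m. \<bar>g l\<bar> * norm1 D (y l))"
proof (induction m)
  case 0
  show ?case by (simp add: lin_comb_def[abs_def] norm1_def)
next
  case (Suc m)
  have "norm1 D (lin_comb (Suc m) g y) = norm1 D (\<lambda>j. lin_comb m g y j + g m * y m j)"
    by (simp add: lin_comb_def[abs_def])
  also have "\<dots> \<le> norm1 D (lin_comb m g y) + \<bar>g m\<bar> * norm1 D (y m)"
    unfolding norm1_scale[symmetric] by (rule norm1_add_le)
  finally show ?case using Suc by simp
qed

lemma l1_norm_eq_norm1: "v \<in> carrier_vec D \<Longrightarrow> l1_norm v = norm1 D (\<lambda>j. v $ j)"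
  by (auto simp: l1_norm_def norm1_def)

lemma l1_norm_sketch:
  assumes "q \<in> carrier_vec D" "v \<in> carrier_vec D"
  shows "l1_norm (mat d D \<omega> *\<^sub>v q - mat d D \<omega> *\<^sub>v v) = sketch_norm d D \<omega> (\<lambda>j. q $ j - v $ j)"
proof -
  have "(mat d D \<omega> *\<^sub>v q - mat d D \<omega> *\<^sub>v v) $ i = row_prod D \<omega> i (\<lambda>j. q $ j - v $ j)" if "i < d" for i
    using that assms
    by (simp add: scalar_prod_def row_prod_def atLeast0LessThan right_diff_distrib sum_subtractf)
  then show ?thesis
    by (simp add: l1_norm_def sketch_norm_def)
qed

lemma l1_dist_range:
  assumes "q \<in> carrier_vec D"
  shows "l1_dist q (range (\<lambda>a. vec D (lin_comb r a w))) = (INF a. norm1 D (\<lambda>j. q $ j - lin_comb r a w j))"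
proof -
  have "l1_norm (q - vec D (lin_comb r a w)) = norm1 D (\<lambda>j. q $ j - lin_comb r a w j)" for a
    using assms by (subst l1_norm_eq_norm1[of _ D]) (auto intro!: norm1_cong)
  then show ?thesis
    by (simp add: l1_dist_def image_comp comp_def)
qed

lemma l1_dist_sketch_range:
  assumes "q \<in> carrier_vec D"
  shows "l1_dist (mat d D \<omega> *\<^sub>v q) ((*\<^sub>v) (mat d D \<omega>) ` range (\<lambda>a. vec D (lin_comb r a w)))
    = (INF a. sketch_norm d D \<omega> (\<lambda>j. q $ j - lin_comb r a w j))"
proof -
  have "l1_norm (mat d D \<omega> *\<^sub>v q - mat d D \<omega> *\<^sub>v vec D (lin_comb r a w))
      = sketch_norm d D \<omega> (\<lambda>j. q $ j - lin_comb r a w j)" for a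
    using assms by (subst l1_norm_sketch) (auto intro!: sketch_norm_cong)
  then show ?thesis
    by (simp add: l1_dist_def image_comp comp_def)
qed

text \<open>Rational coefficients suffice in the infimum, which makes it a countable one.\<close>
lemma measurable_INF_sketch_norm:
  "(\<lambda>\<omega>. INF a. sketch_norm d D \<omega> (\<lambda>j. q j - lin_comb r a w j)) \<in> borel_measurable (cauchy_matrix_law d D)"
proof -
  \<comment> \<open>Lists of rationals form a countable type; positions beyond the end of a list get
    coefficient 0.\<close>
  define R :: "rat list \<Rightarrow> nat \<Rightarrow> real" where "R xs l = (if l < length xs then of_rat (xs ! l) else 0)" for xs l
  define f where "f \<omega> a = sketch_norm d D \<omega> (\<lambda>j. q j - lin_comb r a w j)" for \<omega> a
  have bdd: "bdd_below (f \<omega> ` A)" for \<omega> A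
    by (rule bdd_belowI[of _ 0]) (auto simp: f_def sketch_norm_nonneg)
  have "(INF a. f \<omega> a) = (INF xs. f \<omega> (R xs))" for \<omega>
  proof (rule antisym)
    show "(INF a. f \<omega> a) \<le> (INF xs. f \<omega> (R xs))"
      by (intro cINF_greatest cINF_lower bdd) auto
    show "(INF xs. f \<omega> (R xs)) \<le> (INF a. f \<omega> a)"
    proof (intro cINF_greatest)
      fix a
      show "(INF xs. f \<omega> (R xs)) \<le> f \<omega> a"
      proof (rule field_le_epsilon)
        fix e :: real assume e: "e > 0"
        \<comment> \<open>The summand 1 keeps \<open>N\<close> positive when all the sketched norms
          vanish; coefficients within \<open>e / N\<close> then change the value by at most
          \<open>e / N * (N - 1)\<close>.\<close>
        define N where "N = 1 + (\<Sum>l<r. sketch_norm d D \<omega> (w l))"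
        have N: "N > 0" unfolding N_def by (simp add: add_pos_nonneg sum_nonneg sketch_norm_nonneg)
        have "\<exists>t. \<bar>of_rat t - a l\<bar> \<le> e / N" for l
        proof -
          have "a l < a l + e / N" using e N by simp
          then obtain t where "a l < of_rat t" "of_rat t < a l + e / N"
            using of_rat_dense by blast
          then show ?thesis by (intro exI[of _ t]) auto
        qed
        then obtain t where t: "\<And>l. \<bar>of_rat (t l) - a l\<bar> \<le> e / N" by metis
        define xs where "xs = map t [0..<r]"
        have R: "R xs l = of_rat (t l)" if "l < r" for l
          using that by (simp add: R_def xs_def)
        have "f \<omega> (R xs) = sketch_norm d D \<omega> (\<lambda>j. (q j - lin_comb r a w j) + lin_comb r (\<lambda>l. a l - R xs l) w j)"
          by (simp add: f_def lin_comb_def left_diff_distrib sum_subtractf)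
        also have "\<dots> \<le> f \<omega> a + sketch_norm d D \<omega> (lin_comb r (\<lambda>l. a l - R xs l) w)"
          unfolding f_def by (rule sketch_norm_add_le)
        also have "sketch_norm d D \<omega> (lin_comb r (\<lambda>l. a l - R xs l) w)
            \<le> (\<Sum>l<r. \<bar>a l - R xs l\<bar> * sketch_norm d D \<omega> (w l))"
          by (rule sketch_norm_lin_comb_le)
        also have "\<dots> \<le> (\<Sum>l<r. e / N * sketch_norm d D \<omega> (w l))"
          using t by (intro sum_mono mult_right_mono) (auto simp: R abs_minus_commute sketch_norm_nonneg)
        also have "\<dots> = e / N * (N - 1)"
          by (simp add: N_def sum_distrib_left)
        also have "\<dots> \<le> e"
          using e N by (simp add: field_simps)
        finally have "f \<omega> (R xs) \<le> f \<omega> a + e" by simp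
        moreover have "(INF xs. f \<omega> (R xs)) \<le> f \<omega> (R xs)"
          using bdd[of \<omega> "range R"] by (intro cINF_lower) (auto simp: image_comp comp_def)
        ultimately show "(INF xs. f \<omega> (R xs)) \<le> f \<omega> a + e" by linarith
      qed
    qed auto
  qed
  moreover have "(\<lambda>\<omega>. INF xs. f \<omega> (R xs)) \<in> borel_measurable (cauchy_matrix_law d D)"
    unfolding f_def by (intro borel_measurable_cINF_real) auto
  ultimately show ?thesis
    by (simp add: f_def)
qed

text \<open>Rounding the coefficients down to multiples of \<open>1 / M\<close> leaves an error of
  norm at most \<open>m / M\<close> and of sketched norm at most \<open>m / M * (d * t)\<close>.
  Because \<open>T \<ge> d\<close>, the total loss is at most \<open>T * m * (t + 1) / M\<close>,
  which the condition on \<open>M\<close> bounds by \<open>e * T\<close>. Net points need not have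
  norm 1, so the hypothesis on them is homogeneous.\<close>

lemma sketch_norm_ge_on_net:
  assumes y: "\<And>l. l < m \<Longrightarrow> norm1 D (y l) \<le> 1"
    and rows: "\<And>i l. i < d \<Longrightarrow> l < m \<Longrightarrow> \<bar>row_prod D \<omega> i (y l)\<bar> \<le> t" and t: "t \<ge> 0"
    and M: "M > 0" "real m * (t + 1) \<le> e * real M"
    and T: "T \<ge> real d"
    and net: "\<And>z. z \<in> {..<m} \<rightarrow>\<^sub>E {- 2 * int M..2 * int M} \<Longrightarrow>
       sketch_norm d D \<omega> (lin_comb m (\<lambda>l. z l / M) y) \<ge> T * norm1 D (lin_comb m (\<lambda>l. z l / M) y)"
    and g: "\<And>l. l < m \<Longrightarrow> \<bar>g l\<bar> \<le> 2" and x: "norm1 D (lin_comb m g y) = 1"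
  shows "sketch_norm d D \<omega> (lin_comb m g y) \<ge> (1 - e) * T"
proof -
  define z where "z = (\<lambda>l\<in>{..<m}. \<lfloor>M * g l\<rfloor>)"
  define h where "h l = g l - z l / M" for l
  have z: "z \<in> {..<m} \<rightarrow>\<^sub>E {- 2 * int M..2 * int M}"
  proof -
    have "- 2 * int M \<le> \<lfloor>M * g l\<rfloor> \<and> \<lfloor>M * g l\<rfloor> \<le> 2 * int M" if "l < m" for l
    proof -
      have "\<bar>real M * g l\<bar> \<le> real M * 2"
        unfolding abs_mult using g[OF that] by (simp add: mult_left_mono)
      then have "of_int (- 2 * int M) \<le> real M * g l" "real M * g l \<le> of_int (2 * int M)"
        by simp_all
      then show ?thesis by (metis floor_mono floor_of_int)
    qed
    then show ?thesis by (auto simp: z_def)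
  qed
  have h: "\<bar>h l\<bar> \<le> 1 / M" if "l < m" for l
  proof -
    have "\<bar>M * g l - \<lfloor>M * g l\<rfloor>\<bar> \<le> 1" by linarith
    moreover have "h l = (M * g l - \<lfloor>M * g l\<rfloor>) / M"
      using that M(1) by (simp add: h_def z_def diff_divide_distrib)
    ultimately show ?thesis
      using M(1) by (simp add: abs_divide divide_right_mono)
  qed
  define x' where "x' = lin_comb m (\<lambda>l. z l / M) y"
  have split: "lin_comb m g y = (\<lambda>j. x' j + lin_comb m h y j)"
    by (rule ext) (simp add: x'_def lin_comb_def h_def left_diff_distrib sum_subtractf)
  \<comment> \<open>Written as a sum so that the triangle inequality bounds the sketch of the net
    point from above.\<close>
  have split': "x' = (\<lambda>j. lin_comb m g y j + - 1 * lin_comb m h y j)"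
    by (simp add: split)
  have "norm1 D (lin_comb m h y) \<le> (\<Sum>l<m. \<bar>h l\<bar> * norm1 D (y l))"
    by (rule norm1_lin_comb_le)
  also have "\<dots> \<le> (\<Sum>l<m. 1 / M * 1)"
    using h y by (intro sum_mono mult_mono) (auto simp: norm1_nonneg)
  finally have nh: "norm1 D (lin_comb m h y) \<le> m / M" by simp
  have "1 \<le> norm1 D x' + norm1 D (lin_comb m h y)"
    using norm1_add_le[of D x' "lin_comb m h y"] x by (simp add: split)
  then have nx': "norm1 D x' \<ge> 1 - m / M" using nh by simp
  have "sketch_norm d D \<omega> (y l) \<le> d * t" if "l < m" for l
    unfolding sketch_norm_def using rows that sum_bounded_above[of "{..<d}" "\<lambda>i. \<bar>row_prod D \<omega> i (y l)\<bar>" t]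
    by simp
  then have "(\<Sum>l<m. \<bar>h l\<bar> * sketch_norm d D \<omega> (y l)) \<le> (\<Sum>l<m. 1 / M * (d * t))"
    using h by (intro sum_mono mult_mono) (auto simp: sketch_norm_nonneg)
  then have sh: "sketch_norm d D \<omega> (lin_comb m h y) \<le> m / M * (d * t)"
    using sketch_norm_lin_comb_le[of d D \<omega> m h y] by simp
  have "sketch_norm d D \<omega> x' \<le> sketch_norm d D \<omega> (lin_comb m g y) + sketch_norm d D \<omega> (lin_comb m h y)"
    using sketch_norm_add_le[of d D \<omega> "lin_comb m g y" "\<lambda>j. - 1 * lin_comb m h y j"]
    unfolding split'[symmetric] sketch_norm_scale by simp
  moreover have "T * (1 - m / M) \<le> sketch_norm d D \<omega> x'"
  proof -
    have "T * (1 - m / M) \<le> T * norm1 D x'"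
      using nx' T by (intro mult_left_mono) auto
    also have "\<dots> \<le> sketch_norm d D \<omega> x'"
      unfolding x'_def by (rule net[OF z])
    finally show ?thesis .
  qed
  moreover have "m / M * (d * t) \<le> m / M * (T * t)"
    using T t by (intro mult_left_mono mult_right_mono) auto
  moreover have "(m * (t + 1)) / M * T \<le> e * T"
    using M T by (intro mult_right_mono) (auto simp: divide_simps)
  ultimately show ?thesis
    using sh by (simp add: algebra_simps add_divide_distrib)
qed

section \<open>Union bound\<close>

text \<open>The bad event is a finite union: one of at most \<open>k * d\<close> entries of the
  sketched basis exceeds \<open>t\<close>, or one of at most \<open>(4 * M + 1) ^ k\<close> net
  points has too small a sketch. Outside it the bound holds for all coefficients at once, without a
  measurability question for an uncountable family. The assumption \<open>large\<close> provides
  \<open>T \<ge> d\<close> for the net argument.\<close>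

lemma subspace_sketch_lower_event:
  fixes B e t :: real and M d k :: nat
  assumes B: "B > 0" and e: "0 < e" "e < 1" and t: "t > 0"
    and M: "M > 0" "real k * (t + 1) \<le> e * M"
    and large: "(1 - e) * (ln (1 + B\<^sup>2) / pi) \<ge> 1"
  obtains Bad where "Bad \<in> sets (cauchy_matrix_law d D)"
    "cauchy_matrix.prob d D Bad \<le> k * d / t + (4 * real M + 1) ^ k * exp (- (e\<^sup>2 / 2 * d * (ln (1 + B\<^sup>2) / pi) / B))"
    "\<And>\<omega> a. \<omega> \<in> space (cauchy_matrix_law d D) \<Longrightarrow> \<omega> \<notin> Bad \<Longrightarrow>
      sketch_norm d D \<omega> (lin_comb k a w)
        \<ge> (1 - e) * ((1 - e) * d * (ln (1 + B\<^sup>2) / pi)) * norm1 D (lin_comb k a w)"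
proof -
  let ?P = "cauchy_matrix_law d D"
  define T where "T = (1 - e) * d * (ln (1 + B\<^sup>2) / pi)"
  define p where "p = exp (- (e\<^sup>2 / 2 * d * (ln (1 + B\<^sup>2) / pi) / B))"
  have T: "T \<ge> real d"
    using mult_left_mono[OF large, of "real d"] by (simp add: T_def mult_ac)
  obtain m y where m: "m \<le> k" and y: "\<And>l. l < m \<Longrightarrow> norm1 D (y l) \<le> 1"
    and repr: "\<And>a. \<exists>g. (\<forall>j<D. lin_comb k a w j = lin_comb m g y j) \<and>
       (\<forall>l<m. \<bar>g l\<bar> \<le> 2 * norm1 D (lin_comb k a w))"
    using near_auerbach_basis_exists[of k D w] by blast
  define G where "G = {..<m} \<rightarrow>\<^sub>E {- 2 * int M..2 * int M}"
  have finG: "finite G" by (simp add: G_def finite_PiE)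
  have cardG: "real (card G) \<le> (4 * real M + 1) ^ k"
  proof -
    have "card G = (4 * M + 1) ^ m"
      by (simp add: G_def card_PiE nat_add_distrib nat_mult_distrib)
    also have "real \<dots> \<le> (4 * real M + 1) ^ k"
      using power_increasing[OF m, of "4 * real M + 1"] by (simp add: add.commute)
    finally show ?thesis by simp
  qed
  define pt where "pt z = lin_comb m (\<lambda>l. real_of_int (z l) / M) y" for z
  define R where "R i l = {\<omega> \<in> space ?P. \<bar>row_prod D \<omega> i (y l)\<bar> > t}" for i l
  \<comment> \<open>Net points of norm 0 are left out: their inequality is trivial, but the event
    would be the whole space.\<close>
  define N where "N z = {\<omega> \<in> space ?P. norm1 D (pt z) > 0 \<and> sketch_norm d D \<omega> (pt z) \<le> T * norm1 D (pt z)}" for z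
  define Bad where "Bad = (\<Union>il\<in>{..<d} \<times> {..<m}. R (fst il) (snd il)) \<union> (\<Union>z\<in>G. N z)"
  have R [measurable]: "R i l \<in> sets ?P" if "i < d" for i l
    unfolding R_def using that by measurable
  have N [measurable]: "N z \<in> sets ?P" for z
    unfolding N_def by measurable
  have pR: "cauchy_matrix.prob d D (R i l) \<le> 1 / t" if "i < d" "l < m" for i l
    unfolding R_def using that y t by (intro row_prod_tail) auto
  have pN: "cauchy_matrix.prob d D (N z) \<le> p" for z
  proof (cases "norm1 D (pt z) > 0")
    case True
    then show ?thesis
      using sketch_norm_lower_tail[OF True B e, of d] by (simp add: N_def p_def T_def)
  next
    case False
    then show ?thesis by (simp add: N_def p_def)
  qed
  have Bad: "Bad \<in> sets ?P"
    unfolding Bad_def using finG by (intro sets.Un sets.finite_UN) auto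
  have "cauchy_matrix.prob d D Bad
      \<le> cauchy_matrix.prob d D (\<Union>il\<in>{..<d} \<times> {..<m}. R (fst il) (snd il)) + cauchy_matrix.prob d D (\<Union>z\<in>G. N z)"
    unfolding Bad_def using finG by (intro measure_Un_le sets.finite_UN) auto
  also have "cauchy_matrix.prob d D (\<Union>il\<in>{..<d} \<times> {..<m}. R (fst il) (snd il))
      \<le> (\<Sum>il\<in>{..<d} \<times> {..<m}. cauchy_matrix.prob d D (R (fst il) (snd il)))"
    by (intro cauchy_matrix.finite_measure_subadditive_finite) auto
  also have "\<dots> \<le> (\<Sum>il\<in>{..<d} \<times> {..<m}. 1 / t)"
    by (intro sum_mono) (auto intro: pR)
  also have "\<dots> \<le> k * d / t"
    using m t by (simp add: mult.commute divide_right_mono mult_left_mono)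
  also have "cauchy_matrix.prob d D (\<Union>z\<in>G. N z) \<le> (\<Sum>z\<in>G. cauchy_matrix.prob d D (N z))"
    using finG by (intro cauchy_matrix.finite_measure_subadditive_finite) auto
  also have "\<dots> \<le> (\<Sum>z\<in>G. p)"
    by (intro sum_mono pN)
  also have "\<dots> \<le> (4 * real M + 1) ^ k * p"
    using cardG by (simp add: p_def mult_right_mono)
  finally have prob: "cauchy_matrix.prob d D Bad \<le> k * d / t + (4 * real M + 1) ^ k * p"
    by simp
  have M': "real m * (t + 1) \<le> e * M"
  proof -
    have "real m * (t + 1) \<le> real k * (t + 1)"
      using m t by (intro mult_right_mono) auto
    then show ?thesis using M(2) by simp
  qed
  have lower: "sketch_norm d D \<omega> (lin_comb k a w) \<ge> (1 - e) * T * norm1 D (lin_comb k a w)"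
    if \<omega>: "\<omega> \<in> space ?P" "\<omega> \<notin> Bad" for \<omega> a
  proof -
    define x where "x = lin_comb k a w"
    obtain g where g: "\<forall>j<D. x j = lin_comb m g y j" "\<forall>l<m. \<bar>g l\<bar> \<le> 2 * norm1 D x"
      using repr[of a] by (auto simp: x_def)
    have nx: "norm1 D x = norm1 D (lin_comb m g y)" using g(1) by (intro norm1_cong) auto
    have sx: "sketch_norm d D \<omega> x = sketch_norm d D \<omega> (lin_comb m g y)"
      using g(1) by (intro sketch_norm_cong) auto
    have "(1 - e) * T * norm1 D x \<le> sketch_norm d D \<omega> x"
    proof (cases "norm1 D x = 0")
      case True
      then show ?thesis by (simp add: sketch_norm_nonneg)
    next
      case False
      then have pos: "norm1 D x > 0" using norm1_nonneg[of D x] by simp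
      \<comment> \<open>Both sides are homogeneous. Only after scaling to norm 1 do the coefficients
        fit into the box \<open>{-2..2}\<close> covered by the net.\<close>
      define g' where "g' l = 1 / norm1 D x * g l" for l
      have g'_scale: "norm1 D (lin_comb m g' y) = \<bar>1 / norm1 D x\<bar> * norm1 D x"
        unfolding g'_def lin_comb_scale norm1_scale nx ..
      have g'_sketch: "sketch_norm d D \<omega> (lin_comb m g' y) = \<bar>1 / norm1 D x\<bar> * sketch_norm d D \<omega> x"
        unfolding g'_def lin_comb_scale sketch_norm_scale sx ..
      have "(1 - e) * T \<le> sketch_norm d D \<omega> (lin_comb m g' y)"
      proof (rule sketch_norm_ge_on_net[OF y _ _ M(1) M' T])
        show "\<bar>row_prod D \<omega> i (y l)\<bar> \<le> t" if "i < d" "l < m" for i l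
          using \<omega> that by (force simp: Bad_def R_def)
        show "T * norm1 D (lin_comb m (\<lambda>l. z l / M) y) \<le> sketch_norm d D \<omega> (lin_comb m (\<lambda>l. z l / M) y)"
          if z: "z \<in> {..<m} \<rightarrow>\<^sub>E {- 2 * int M..2 * int M}" for z
        proof (cases "norm1 D (pt z) > 0")
          case True
          have "\<omega> \<notin> N z" using \<omega> z by (auto simp: Bad_def G_def)
          then show ?thesis using True \<omega> by (auto simp: N_def pt_def)
        next
          case False
          then have "norm1 D (pt z) = 0" using norm1_nonneg[of D "pt z"] by simp
          then show ?thesis using sketch_norm_nonneg[of d D \<omega> "pt z"] by (simp add: pt_def)
        qed
        show "\<bar>g' l\<bar> \<le> 2" if "l < m" for l
          using g(2) that pos by (simp add: g'_def abs_mult divide_simps)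
        show "norm1 D (lin_comb m g' y) = 1"
          using g'_scale pos by simp
      qed (use t in auto)
      then show ?thesis
        using pos by (simp add: g'_sketch divide_simps)
    qed
    then show ?thesis by (simp add: x_def)
  qed
  show ?thesis
    by (rule that[OF Bad]) (use prob lower in \<open>auto simp: p_def T_def\<close>)
qed

text \<open>Outside the bad events the chain of inequalities loses \<open>1 + e\<close> twice on the
  side of \<open>s\<close>, by choosing an approximate minimizer and by Markov's inequality, and
  \<open>1 - e\<close> twice on the other side, by the Chernoff bound and by the net. This is the
  origin of the squares in \<open>gap\<close>.\<close>

lemma nearest_subspace_preserved:
  fixes B e t K c \<eta> :: real and M d D n r :: nat and q :: "nat \<Rightarrow> real" and w :: "nat \<Rightarrow> nat \<Rightarrow> nat \<Rightarrow> real"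
    and \<delta> :: "nat \<Rightarrow> real"
  defines "\<delta> \<equiv> \<lambda>i. INF a. norm1 D (\<lambda>j. q j - lin_comb r a (w i) j)"
  assumes B: "B > 0" and e: "0 < e" "e < 1" and t: "t > 0" and d: "d > 0" and K: "K > 0"
    and M: "M > 0" "real (Suc r) * (t + 1) \<le> e * M"
    and large: "(1 - e) * (ln (1 + B\<^sup>2) / pi) \<ge> 1"
    and gap: "(1 + e)\<^sup>2 * ln (1 + (K * d)\<^sup>2) < (1 - e)\<^sup>2 * ln (1 + B\<^sup>2) * \<eta>"
    and fail: "1 / (1 + e) + 1 / K + n * (Suc r * d / t
        + (4 * real M + 1) ^ Suc r * exp (- (e\<^sup>2 / 2 * d * (ln (1 + B\<^sup>2) / pi) / B))) \<le> 1 - c"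
    and s: "s \<in> {1..n}" "\<delta> s > 0" and others: "\<And>i. i \<in> {1..n} - {s} \<Longrightarrow> \<delta> i \<ge> \<eta> * \<delta> s"
  shows "cauchy_matrix.prob d D {\<omega> \<in> space (cauchy_matrix_law d D). \<forall>i\<in>{1..n} - {s}.
      (INF a. sketch_norm d D \<omega> (\<lambda>j. q j - lin_comb r a (w s) j))
        < (INF a. sketch_norm d D \<omega> (\<lambda>j. q j - lin_comb r a (w i) j))} \<ge> c"
proof -
  let ?P = "cauchy_matrix_law d D"
  define \<mu> where "\<mu> = ln (1 + B\<^sup>2) / pi"
  define \<kappa> where "\<kappa> = ln (1 + (K * d)\<^sup>2) / pi"
  define x where "x i a = (\<lambda>j. q j - lin_comb r a (w i) j)" for i a
  define L where "L i \<omega> = (INF a. sketch_norm d D \<omega> (x i a))" for i \<omega>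
  define bound where "bound = Suc r * d / t + (4 * real M + 1) ^ Suc r * exp (- (e\<^sup>2 / 2 * d * \<mu> / B))"
  have \<delta>: "\<delta> i = (INF a. norm1 D (x i a))" for i
    by (simp add: \<delta>_def x_def)
  have \<delta>_le: "\<delta> i \<le> norm1 D (x i a)" for i a
    unfolding \<delta> by (rule cINF_lower) (auto intro!: bdd_belowI[of _ 0] norm1_nonneg)
  have L_le: "L i \<omega> \<le> sketch_norm d D \<omega> (x i a)" for i \<omega> a
    unfolding L_def by (rule cINF_lower) (auto intro!: bdd_belowI[of _ 0] sketch_norm_nonneg)
  have L_meas [measurable]: "L i \<in> borel_measurable ?P" for i
    unfolding L_def x_def by (rule measurable_INF_sketch_norm)
  \<comment> \<open>The query is adjoined as the last generator, so that every residual
    \<open>q - v\<close> with \<open>v\<close> in the subspace lies in one linear space, with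
    coefficient 1 at \<open>q\<close>.\<close>
  define w' where "w' i l = (if l < r then w i l else q)" for i l
  have x_lin: "\<exists>b. x i a = lin_comb (Suc r) b (w' i)" for i a
    by (intro exI[of _ "\<lambda>l. if l < r then - a l else 1"])
      (auto simp: x_def lin_comb_def w'_def sum_negf)
  have "\<exists>Bad. Bad \<in> sets ?P \<and> cauchy_matrix.prob d D Bad \<le> bound \<and>
      (\<forall>\<omega>\<in>space ?P - Bad. \<forall>a. sketch_norm d D \<omega> (x i a) \<ge> (1 - e) * ((1 - e) * d * \<mu>) * norm1 D (x i a))" for i
  proof -
    obtain Bad where "Bad \<in> sets ?P" "cauchy_matrix.prob d D Bad \<le> bound"
      "\<And>\<omega> a. \<omega> \<in> space ?P \<Longrightarrow> \<omega> \<notin> Bad \<Longrightarrow> sketch_norm d D \<omega> (lin_comb (Suc r) a (w' i))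
        \<ge> (1 - e) * ((1 - e) * d * \<mu>) * norm1 D (lin_comb (Suc r) a (w' i))"
      using subspace_sketch_lower_event[OF B e t M large, of d D "w' i"] unfolding bound_def \<mu>_def by blast
    then show ?thesis using x_lin by (metis DiffE)
  qed
  then obtain Bad where Bad [measurable]: "\<And>i. Bad i \<in> sets ?P"
    and pBad: "\<And>i. cauchy_matrix.prob d D (Bad i) \<le> bound"
    and lower: "\<And>i \<omega> a. \<omega> \<in> space ?P \<Longrightarrow> \<omega> \<notin> Bad i \<Longrightarrow>
      sketch_norm d D \<omega> (x i a) \<ge> (1 - e) * ((1 - e) * d * \<mu>) * norm1 D (x i a)"
    by (metis DiffI)
  \<comment> \<open>An approximate minimizer makes attainment of the infimum unnecessary. It does
    not depend on \<open>\<omega>\<close>, so the upper tail for a fixed vector applies to its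
    residual.\<close>
  obtain a where a: "norm1 D (x s a) < (1 + e) * \<delta> s"
  proof -
    have "(INF a. norm1 D (x s a)) < (1 + e) * \<delta> s"
      using s e by (simp add: \<delta>[symmetric])
    then show ?thesis
      using that by (subst (asm) cINF_less_iff) (auto intro!: bdd_belowI[of _ 0] norm1_nonneg)
  qed
  have pos: "norm1 D (x s a) > 0"
    using s \<delta>_le[of s a] by simp
  define U where "U = {\<omega> \<in> space ?P. sketch_norm d D \<omega> (x s a) \<ge> (1 + e) * d * \<kappa> * norm1 D (x s a)}"
  have U [measurable]: "U \<in> sets ?P" unfolding U_def by measurable
  have pU: "cauchy_matrix.prob d D U \<le> 1 / (1 + e) + 1 / K"
    unfolding U_def \<kappa>_def by (rule sketch_norm_upper_tail[OF pos d K e(1)])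
  define V where "V = U \<union> (\<Union>i\<in>{1..n}. Bad i)"
  have V [measurable]: "V \<in> sets ?P" unfolding V_def by (intro sets.Un sets.finite_UN) auto
  have "cauchy_matrix.prob d D V \<le> cauchy_matrix.prob d D U + cauchy_matrix.prob d D (\<Union>i\<in>{1..n}. Bad i)"
    unfolding V_def by (intro measure_Un_le sets.finite_UN) auto
  also have "cauchy_matrix.prob d D (\<Union>i\<in>{1..n}. Bad i) \<le> (\<Sum>i\<in>{1..n}. cauchy_matrix.prob d D (Bad i))"
    by (intro cauchy_matrix.finite_measure_subadditive_finite) auto
  also have "\<dots> \<le> n * bound"
    using sum_bounded_above[of "{1..n}" "\<lambda>i. cauchy_matrix.prob d D (Bad i)" bound] pBad by simp
  finally have pV: "cauchy_matrix.prob d D V \<le> 1 - c"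
    using pU fail by (simp add: bound_def \<mu>_def)
  have \<kappa>: "\<kappa> \<ge> 0" by (simp add: \<kappa>_def)
  have good: "L s \<omega> < L i \<omega>" if \<omega>: "\<omega> \<in> space ?P" "\<omega> \<notin> V" and i: "i \<in> {1..n} - {s}" for \<omega> i
  proof -
    have "\<mu> \<ge> 0" by (simp add: \<mu>_def)
    have "L s \<omega> \<le> sketch_norm d D \<omega> (x s a)" by (rule L_le)
    also have "\<dots> \<le> (1 + e) * d * \<kappa> * norm1 D (x s a)"
      using \<omega> by (auto simp: V_def U_def)
    also have "\<dots> \<le> (1 + e) * d * \<kappa> * ((1 + e) * \<delta> s)"
      using a e \<kappa> by (intro mult_left_mono) auto
    also have "\<dots> = ((1 + e)\<^sup>2 * \<kappa>) * (d * \<delta> s)"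
      by (simp add: power2_eq_square mult_ac)
    also have "\<dots> < ((1 - e)\<^sup>2 * \<mu> * \<eta>) * (d * \<delta> s)"
    proof (rule mult_strict_right_mono)
      have "(1 + e)\<^sup>2 * ln (1 + (K * d)\<^sup>2) / pi < (1 - e)\<^sup>2 * ln (1 + B\<^sup>2) * \<eta> / pi"
        using gap by (intro divide_strict_right_mono) auto
      then show "(1 + e)\<^sup>2 * \<kappa> < (1 - e)\<^sup>2 * \<mu> * \<eta>"
        by (simp add: \<kappa>_def \<mu>_def)
    qed (use d s in auto)
    also have "\<dots> = (1 - e) * ((1 - e) * d * \<mu>) * (\<eta> * \<delta> s)"
      by (simp add: power2_eq_square mult_ac)
    also have "\<dots> \<le> (1 - e) * ((1 - e) * d * \<mu>) * \<delta> i"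
      using others[OF i] e \<open>\<mu> \<ge> 0\<close> by (intro mult_left_mono) auto
    also have "\<dots> \<le> L i \<omega>"
      unfolding L_def
    proof (rule cINF_greatest)
      fix b
      have "(1 - e) * ((1 - e) * d * \<mu>) * \<delta> i \<le> (1 - e) * ((1 - e) * d * \<mu>) * norm1 D (x i b)"
        using e \<open>\<mu> \<ge> 0\<close> by (intro mult_left_mono \<delta>_le) auto
      also have "\<dots> \<le> sketch_norm d D \<omega> (x i b)"
        using \<omega> i by (intro lower) (auto simp: V_def)
      finally show "(1 - e) * ((1 - e) * d * \<mu>) * \<delta> i \<le> sketch_norm d D \<omega> (x i b)" .
    qed simp
    finally show ?thesis .
  qed
  have "c \<le> 1 - cauchy_matrix.prob d D V" using pV by simp
  also have "\<dots> = cauchy_matrix.prob d D (space ?P - V)"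
    by (rule cauchy_matrix.prob_compl[symmetric]) fact
  also have "\<dots> \<le> cauchy_matrix.prob d D {\<omega> \<in> space ?P. \<forall>i\<in>{1..n} - {s}. L s \<omega> < L i \<omega>}"
  proof (rule cauchy_matrix.finite_measure_mono)
    show "space ?P - V \<subseteq> {\<omega> \<in> space ?P. \<forall>i\<in>{1..n} - {s}. L s \<omega> < L i \<omega>}"
      using good by blast
  qed measurable
  finally show ?thesis
    by (simp add: L_def x_def)
qed

section \<open>Choice of the constants\<close>

text \<open>The truncation level is \<open>B = d powr (1 - \<alpha>)\<close>,
  so that the exponent \<open>d / B\<close> of the lower tail is \<open>d powr \<alpha>\<close>.\<close>
lemma sketch_parameters_exist:
  fixes \<eta> \<alpha> :: real
  assumes \<eta>: "\<eta> > 1" and \<alpha>: "0 < \<alpha>" "\<alpha> < 1 - 1 / \<eta>"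
  obtains C c e K :: real where "C > 0" "c > 0" "0 < e" "e < 1" "K > 0"
    "\<And>n r :: nat. n > r \<Longrightarrow> r \<ge> 1 \<Longrightarrow> \<exists>(d::nat) t (M::nat). d > 0 \<and>
      real d \<le> C * (real r * ln (real n)) powr (1 / \<alpha>) \<and> t > 0 \<and> M > 0 \<and>
      real (Suc r) * (t + 1) \<le> e * M \<and>
      (1 - e) * (ln (1 + (real d powr (1 - \<alpha>))\<^sup>2) / pi) \<ge> 1 \<and>
      (1 + e)\<^sup>2 * ln (1 + (K * d)\<^sup>2) < (1 - e)\<^sup>2 * ln (1 + (real d powr (1 - \<alpha>))\<^sup>2) * \<eta> \<and>
      1 / (1 + e) + 1 / K + n * (Suc r * d / t + (4 * real M + 1) ^ Suc r *
        exp (- (e\<^sup>2 / 2 * d * (ln (1 + (real d powr (1 - \<alpha>))\<^sup>2) / pi) / (real d powr (1 - \<alpha>))))) \<le> 1 - c"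
proof -
  \<comment> \<open>The limit of
    \<open>\<eta> * ln (1 + B\<^sup>2) / ln (1 + (K * d)\<^sup>2)\<close> as \<open>d\<close> grows,
    with \<open>B = d powr (1 - \<alpha>)\<close>.\<close>
  define \<rho> where "\<rho> = \<eta> * (1 - \<alpha>)"
  have \<alpha>1: "\<alpha> < 1"
  proof -
    have "1 / \<eta> > 0" using \<eta> by simp
    then show ?thesis using \<alpha> by linarith
  qed
  have \<rho>: "\<rho> > 1"
  proof -
    have "1 = \<eta> * (1 / \<eta>)" using \<eta> by simp
    also have "\<dots> < \<eta> * (1 - \<alpha>)" using \<alpha> \<eta> by (intro mult_strict_left_mono) auto
    finally show ?thesis by (simp add: \<rho>_def)
  qed
  define s where "s = sqrt \<rho>"
  have s: "s > 1" "s\<^sup>2 = \<rho>" using \<rho> by (auto simp: s_def)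
  \<comment> \<open>Half of \<open>(s - 1) / (s + 1)\<close>, the value at which
    \<open>1 + e\<close> would equal \<open>(1 - e) * s\<close>.\<close>
  define e where "e = (s - 1) / (2 * (s + 1))"
  have e: "0 < e" "e < 1" using s by (auto simp: e_def divide_simps)
  have "e * (s + 1) = (s - 1) / 2" using s by (simp add: e_def field_simps)
  then have "1 + e < (1 - e) * s"
    using s by (simp add: algebra_simps)
  then have "(1 + e)\<^sup>2 < ((1 - e) * s)\<^sup>2"
    using e by (intro power_strict_mono) auto
  then have e_gap: "(1 + e)\<^sup>2 * 2 < (1 - e)\<^sup>2 * (2 * \<rho>)"
    by (simp add: power_mult_distrib s)
  \<comment> \<open>The slack that Markov's inequality leaves below 1. It is split into quarters:
    for \<open>1 / K\<close>, for the large entries, for the net points, and for the success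
    probability \<open>c\<close>.\<close>
  define \<tau> where "\<tau> = e / (1 + e)"
  have \<tau>: "0 < \<tau>" "\<tau> < 1" using e by (auto simp: \<tau>_def)
  have \<tau>_eq: "1 / (1 + e) = 1 - \<tau>" using e by (simp add: \<tau>_def divide_simps)
  define K where "K = 4 / \<tau>"
  have K: "K > 0" using \<tau> by (simp add: K_def)
  have "((\<lambda>x. (1 + e)\<^sup>2 * (ln (1 + (K * x)\<^sup>2) / ln x)) \<longlongrightarrow> (1 + e)\<^sup>2 * 2) at_top"
    using K by (intro tendsto_mult tendsto_const) real_asymp
  then have ev1: "eventually (\<lambda>x. (1 + e)\<^sup>2 * (ln (1 + (K * x)\<^sup>2) / ln x) < (1 - e)\<^sup>2 * (2 * \<rho>)) at_top"
    using e_gap by (rule order_tendstoD)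
  have ev2: "eventually (\<lambda>x. ln x \<ge> max 1 (pi / ((1 - e) * (2 * (1 - \<alpha>))))) (at_top :: real filter)"
    using ln_at_top unfolding filterlim_at_top by blast
  obtain d0 where d0: "\<And>x. x \<ge> d0 \<Longrightarrow> (1 + e)\<^sup>2 * (ln (1 + (K * x)\<^sup>2) / ln x) < (1 - e)\<^sup>2 * (2 * \<rho>)"
    "\<And>x. x \<ge> d0 \<Longrightarrow> ln x \<ge> max 1 (pi / ((1 - e) * (2 * (1 - \<alpha>))))"
    using eventually_conj[OF ev1 ev2] by (auto simp: eventually_at_top_linorder)
  \<comment> \<open>The exponent of the lower tail is at least
    \<open>c_low * ln d * d powr \<alpha>\<close>.\<close>
  define c_low where "c_low = e\<^sup>2 * (1 - \<alpha>) / pi"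
  have c_low: "c_low > 0" using e \<alpha>1 by (simp add: c_low_def)
  \<comment> \<open>Chosen such that \<open>4 * M + 1 \<le> Q * n ^ 3 * d\<close>, where
    \<open>Suc r \<le> n\<close> removes \<open>r\<close> from the bound.\<close>
  define Q where "Q = 16 / (\<tau> * e) + 4 / e + 5"
  have Q: "Q \<ge> 1" using \<tau> e by (simp add: Q_def add_nonneg_nonneg)
  \<comment> \<open>The union bound needs an exponent of at most
    \<open>c_net * r * ln n * ln d\<close>; the 11 collects one \<open>ln n\<close> from the number
    of subspaces and 6 + 4 from the logarithm of the net size.\<close>
  define c_net where "c_net = 2 * ln (4 / \<tau>) + 4 * ln Q + 11"
  have c_net: "c_net > 0" using \<tau> Q by (simp add: c_net_def add_nonneg_pos)
  \<comment> \<open>The least value of \<open>(r * ln n) powr (1 / \<alpha>)\<close>, since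
    \<open>n \<ge> 2\<close>. The term \<open>1 / x0\<close> in the constant absorbs the rounding of
    \<open>d\<close> up to an integer.\<close>
  define x0 where "x0 = ln 2 powr (1 / \<alpha>)"
  have x0: "x0 > 0" by (simp add: x0_def)
  \<comment> \<open>The first entry makes \<open>c_low * d powr \<alpha>\<close> at least
    \<open>c_net * r * ln n\<close>; the second makes \<open>d\<close> at least
    \<open>d0\<close>.\<close>
  define A where "A = max ((c_net / c_low) powr (1 / \<alpha>)) (d0 / x0)"
  have A: "A > 0" using c_net c_low by (simp add: A_def less_max_iff_disj)
  have main: "\<exists>(d::nat) t (M::nat). d > 0 \<and>
      real d \<le> (A + 1 / x0) * (real r * ln (real n)) powr (1 / \<alpha>) \<and> t > 0 \<and> M > 0 \<and>
      real (Suc r) * (t + 1) \<le> e * M \<and>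
      (1 - e) * (ln (1 + (real d powr (1 - \<alpha>))\<^sup>2) / pi) \<ge> 1 \<and>
      (1 + e)\<^sup>2 * ln (1 + (K * d)\<^sup>2) < (1 - e)\<^sup>2 * ln (1 + (real d powr (1 - \<alpha>))\<^sup>2) * \<eta> \<and>
      1 / (1 + e) + 1 / K + n * (Suc r * d / t + (4 * real M + 1) ^ Suc r *
        exp (- (e\<^sup>2 / 2 * d * (ln (1 + (real d powr (1 - \<alpha>))\<^sup>2) / pi) / (real d powr (1 - \<alpha>))))) \<le> 1 - \<tau> / 4"
    if nr: "n > r" "r \<ge> 1" for n r :: nat
  proof -
    define L where "L = ln (real n)"
    have L: "L \<ge> ln 2" using nr by (simp add: L_def)
    have L_half: "2 * L \<ge> 1" using L ln2_ge_two_thirds by linarith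
    define x where "x = (real r * L) powr (1 / \<alpha>)"
    have "ln 2 \<le> real r * L"
      using mult_mono[of 1 "real r" "ln 2" L] nr L by simp
    then have x: "x \<ge> x0"
      unfolding x_def x0_def using \<alpha> by (intro powr_mono2) auto
    define d where "d = nat \<lceil>A * x\<rceil>"
    have Ax: "A * x > 0" using A x x0 by simp
    have d_ge: "real d \<ge> A * x" unfolding d_def using Ax by linarith
    have d: "d > 0" using d_ge Ax by (cases d) auto
    have "real d \<le> A * x + 1" unfolding d_def using Ax by linarith
    also have "1 \<le> 1 / x0 * x" using x x0 by simp
    finally have d_le: "real d \<le> (A + 1 / x0) * x" by (simp add: distrib_right)
    have "d0 = d0 / x0 * x0" using x0 by simp
    also have "\<dots> \<le> A * x0" using x0 by (intro mult_right_mono) (auto simp: A_def)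
    also have "\<dots> \<le> A * x" using A x by (intro mult_left_mono) auto
    finally have d_d0: "real d \<ge> d0" using d_ge by linarith
    define G where "G = ln (real d)"
    have G: "G \<ge> 1" "G \<ge> pi / ((1 - e) * (2 * (1 - \<alpha>)))"
      using d0(2)[OF d_d0] by (auto simp: G_def)
    define B where "B = real d powr (1 - \<alpha>)"
    have B: "B > 0" using d by (simp add: B_def)
    have lnB: "ln (1 + B\<^sup>2) \<ge> 2 * (1 - \<alpha>) * G"
    proof -
      have "2 * (1 - \<alpha>) * G = ln (B\<^sup>2)"
        using d B by (simp add: B_def G_def ln_realpow ln_powr)
      also have "\<dots> \<le> ln (1 + B\<^sup>2)" using B by (intro ln_mono) auto
      finally show ?thesis .
    qed
    have large: "(1 - e) * (ln (1 + B\<^sup>2) / pi) \<ge> 1"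
    proof -
      have "pi \<le> (1 - e) * (2 * (1 - \<alpha>)) * G"
        using G(2) e \<alpha>1 by (simp add: divide_simps mult_ac)
      also have "\<dots> \<le> (1 - e) * ln (1 + B\<^sup>2)"
        using lnB e by (simp add: mult.assoc mult_left_mono)
      finally show ?thesis by (simp add: divide_simps)
    qed
    have gap: "(1 + e)\<^sup>2 * ln (1 + (K * d)\<^sup>2) < (1 - e)\<^sup>2 * ln (1 + B\<^sup>2) * \<eta>"
    proof -
      have "(1 + e)\<^sup>2 * ln (1 + (K * d)\<^sup>2) = (1 + e)\<^sup>2 * (ln (1 + (K * d)\<^sup>2) / G) * G"
        using G by simp
      also have "\<dots> < (1 - e)\<^sup>2 * (2 * \<rho>) * G"
        using d0(1)[OF d_d0] G by (intro mult_strict_right_mono) (auto simp: G_def)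
      also have "\<dots> = (1 - e)\<^sup>2 * (2 * (1 - \<alpha>) * G) * \<eta>"
        by (simp add: \<rho>_def mult_ac)
      also have "\<dots> \<le> (1 - e)\<^sup>2 * ln (1 + B\<^sup>2) * \<eta>"
        using lnB \<eta> by (intro mult_right_mono mult_left_mono) auto
      finally show ?thesis .
    qed
    \<comment> \<open>Solves \<open>n * (Suc r * d / t) = \<tau> / 4\<close>.\<close>
    define t where "t = 4 * real n * Suc r * d / \<tau>"
    have t: "t > 0" using nr d \<tau> by (simp add: t_def)
    define M where "M = nat \<lceil>Suc r * (t + 1) / e\<rceil>"
    have M_ge: "M \<ge> Suc r * (t + 1) / e" unfolding M_def by linarith
    have M_pos: "M > 0"
    proof -
      have "Suc r * (t + 1) / e > 0" using t e by simp
      then show ?thesis using M_ge by (cases M) auto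
    qed
    have M_e: "real (Suc r) * (t + 1) \<le> e * M"
      using M_ge e by (simp add: divide_simps mult_ac)
    have rn: "real (Suc r) \<le> real n" using nr by simp
    have nd: "real n \<ge> 1" "real d \<ge> 1" using nr d by auto
    have M_le: "4 * real M + 1 \<le> Q * real n ^ 3 * d"
    proof -
      have "Suc r * (t + 1) / e \<ge> 0" using t e by simp
      then have "real M \<le> Suc r * (t + 1) / e + 1" unfolding M_def by linarith
      also have "Suc r * (t + 1) / e \<le> real n * (4 * real n * real n * d / \<tau> + 1) / e"
        unfolding t_def using rn e \<tau> by (intro divide_right_mono mult_mono add_right_mono mult_left_mono) auto
      finally have "4 * real M + 1 \<le> 16 / (\<tau> * e) * (real n ^ 3 * d) + 4 / e * real n + 5"
        using e \<tau> by (simp add: field_simps power3_eq_cube)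
      also have "\<dots> \<le> 16 / (\<tau> * e) * (real n ^ 3 * d) + 4 / e * (real n ^ 3 * d) + 5 * (real n ^ 3 * d)"
      proof -
        have "real n ^ 1 \<le> real n ^ 3" using nd by (intro power_increasing) auto
        then have "real n * 1 \<le> real n ^ 3 * d" using nd by (intro mult_mono) auto
        then have "real n \<le> real n ^ 3 * d" "1 \<le> real n ^ 3 * d" using nd by auto
        then show ?thesis using e \<tau> by (intro add_mono mult_left_mono) auto
      qed
      also have "\<dots> = Q * real n ^ 3 * d" by (simp add: Q_def algebra_simps)
      finally show ?thesis .
    qed
    define E where "E = e\<^sup>2 / 2 * d * (ln (1 + B\<^sup>2) / pi) / B"
    have E: "E \<ge> c_net * (r * L * G)"
    proof -
      have dB: "real d / B = real d powr \<alpha>"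
        unfolding B_def using d powr_diff[of "real d" 1 "1 - \<alpha>"] by simp
      have "c_low * G * real d powr \<alpha> = e\<^sup>2 / 2 * ((2 * (1 - \<alpha>) * G) / pi) * real d powr \<alpha>"
        by (simp add: c_low_def mult.assoc del: right_diff_distrib_numeral)
      also have "\<dots> \<le> e\<^sup>2 / 2 * (ln (1 + B\<^sup>2) / pi) * real d powr \<alpha>"
        using lnB by (intro mult_right_mono mult_left_mono divide_right_mono) auto
      also have "\<dots> = E"
        unfolding E_def dB[symmetric] by simp
      finally have 1: "c_low * G * real d powr \<alpha> \<le> E" .
      have rL: "real r * L \<ge> 0" using \<open>ln 2 \<le> real r * L\<close> ln2_ge_two_thirds by linarith
      have "c_net / c_low * (r * L) = ((c_net / c_low) powr (1 / \<alpha>)) powr \<alpha> * (x powr \<alpha>)"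
        using c_net c_low rL \<alpha> by (simp add: x_def powr_powr)
      also have "\<dots> = ((c_net / c_low) powr (1 / \<alpha>) * x) powr \<alpha>"
        using x x0 by (simp add: powr_mult)
      also have "\<dots> \<le> (A * x) powr \<alpha>"
        using x x0 \<alpha> by (intro powr_mono2 mult_right_mono) (auto simp: A_def)
      also have "\<dots> \<le> real d powr \<alpha>"
        using d_ge Ax \<alpha> by (intro powr_mono2) auto
      finally have "c_low * G * (c_net / c_low * (r * L)) \<le> c_low * G * real d powr \<alpha>"
        using c_low G by (intro mult_left_mono) auto
      then show ?thesis using 1 c_low by (simp add: mult_ac)
    qed
    \<comment> \<open>A common majorant for all the terms of the union bound. The factors 2 are due
      to \<open>L\<close>, which may be below 1 but is at least \<open>1 / 2\<close>.\<close>
    define P where "P = real r * L * G"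
    have P: "r * L \<le> P" "L \<le> P" "1 \<le> 2 * P" "r \<le> 2 * P" "r * G \<le> 2 * P"
    proof -
      have rL: "real r * L \<ge> 0" "L \<ge> 0" using \<open>ln 2 \<le> real r * L\<close> ln2_ge_two_thirds L by linarith+
      show 1: "r * L \<le> P" using mult_left_mono[OF G(1) rL(1)] by (simp add: P_def)
      have "L \<le> r * L" using nr rL mult_right_mono[of 1 "real r" L] by simp
      then show "L \<le> P" using 1 by linarith
      then show "1 \<le> 2 * P" using L_half by linarith
      have "real r * 1 \<le> r * (2 * L)" using L_half by (intro mult_left_mono) auto
      then show "r \<le> 2 * P" using 1 by simp
      have "real r * G * 1 \<le> r * G * (2 * L)" using L_half G by (intro mult_left_mono) auto
      then show "r * G \<le> 2 * P" by (simp add: P_def mult_ac)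
    qed
    have ln_bound: "ln (4 / \<tau>) + L + Suc r * ln (4 * real M + 1) \<le> E"
    proof -
      have "ln (4 * real M + 1) \<le> ln (Q * real n ^ 3 * d)"
        using M_le by (intro ln_mono) auto
      also have "\<dots> = ln Q + 3 * L + G"
        using Q nd by (simp add: ln_mult ln_realpow L_def G_def)
      finally have l: "ln (4 * real M + 1) \<le> ln Q + 3 * L + G" .
      have l0: "0 \<le> ln Q + 3 * L + G" using Q L_half G by simp
      have "Suc r * ln (4 * real M + 1) \<le> Suc r * (ln Q + 3 * L + G)"
        using l by (intro mult_left_mono) auto
      also have "\<dots> \<le> (2 * real r) * (ln Q + 3 * L + G)"
        using nr l0 by (intro mult_right_mono) auto
      also have "\<dots> = 2 * ln Q * r + 6 * (r * L) + 2 * (r * G)"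
        by (simp add: algebra_simps)
      also have "2 * ln Q * r \<le> 2 * ln Q * (2 * P)"
        using P(4) Q by (intro mult_left_mono) auto
      finally have "Suc r * ln (4 * real M + 1) \<le> 4 * ln Q * P + 6 * P + 4 * P"
        using P by linarith
      moreover have "ln (4 / \<tau>) * 1 \<le> ln (4 / \<tau>) * (2 * P)"
        using P(3) \<tau> by (intro mult_left_mono) auto
      ultimately have "ln (4 / \<tau>) + L + Suc r * ln (4 * real M + 1) \<le> c_net * P"
        using P(2) by (simp add: c_net_def algebra_simps)
      then show ?thesis using E by (simp add: P_def)
    qed
    have exp_bound: "n * ((4 * real M + 1) ^ Suc r * exp (- E)) \<le> \<tau> / 4"
    proof -
      have "4 / \<tau> * (n * (4 * real M + 1) ^ Suc r) = exp (ln (4 / \<tau>) + L + Suc r * ln (4 * real M + 1))"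
      proof -
        have "exp (Suc r * ln (4 * real M + 1)) = (4 * real M + 1) ^ Suc r"
          unfolding exp_of_nat_mult by simp
        then show ?thesis
          using \<tau> nr by (simp only: exp_add) (simp add: L_def)
      qed
      also have "\<dots> \<le> exp E" using ln_bound by simp
      finally have "4 / \<tau> * (n * (4 * real M + 1) ^ Suc r) * exp (- E) \<le> exp E * exp (- E)"
        by (intro mult_right_mono) auto
      then show ?thesis using \<tau> by (simp add: exp_minus field_simps)
    qed
    have first: "n * (Suc r * d / t) = \<tau> / 4"
      using nr d \<tau> by (simp add: t_def del: of_nat_Suc mult_Suc)
    define X where "X = n * ((4 * real M + 1) ^ Suc r * exp (- E))"
    have K_eq: "1 / K = \<tau> / 4" by (simp add: K_def)
    have "1 / (1 + e) + 1 / K + n * (Suc r * d / t + (4 * real M + 1) ^ Suc r * exp (- E)) \<le> 1 - \<tau> / 4"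
      using exp_bound unfolding \<tau>_eq distrib_left first K_eq X_def[symmetric] by linarith
    then show ?thesis
      using d d_le t M_pos M_e large gap unfolding E_def B_def x_def L_def by blast
  qed
  show ?thesis
  proof (rule that[of "A + 1 / x0" "\<tau> / 4" e K])
    show "A + 1 / x0 > 0" using A x0 by (simp add: add_pos_pos)
  qed (fact main | use \<tau> e K in simp)+
qed

section \<open>From sorted distances and sets of minimizers to strict inequalities\<close>

lemma arg_min_set_eq_singleton_iff:
  assumes "s \<in> A"
  shows "arg_min_set f A = {s} \<longleftrightarrow> (\<forall>i\<in>A - {s}. f s < f i)"
proof
  assume *: "arg_min_set f A = {s}"
  then have "s \<in> arg_min_set f A" by simp
  then have s: "f s \<le> f y" if "y \<in> A" for y
    using that by (auto simp: arg_min_set_def is_arg_min_def not_less)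
  show "\<forall>i\<in>A - {s}. f s < f i"
  proof
    fix i assume i: "i \<in> A - {s}"
    then have "i \<notin> arg_min_set f A" using * by auto
    then obtain y where "y \<in> A" "f y < f i"
      using i by (auto simp: arg_min_set_def is_arg_min_def)
    then show "f s < f i" using s[of y] by simp
  qed
next
  assume *: "\<forall>i\<in>A - {s}. f s < f i"
  then have "f s \<le> f y" if "y \<in> A" for y
    using that by (cases "y = s") (auto intro: less_imp_le)
  then have "s \<in> arg_min_set f A"
    using assms by (auto simp: arg_min_set_def is_arg_min_def not_less)
  moreover have "i = s" if "i \<in> arg_min_set f A" for i
    using that * assms by (auto simp: arg_min_set_def is_arg_min_def)
  ultimately show "arg_min_set f A = {s}" by blast
qed

text \<open>Distances may coincide, so the second entry of the sorted list must be compared with the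
  values at the other indices, counted with multiplicity.\<close>

lemma sort_map_first_two:
  fixes f :: "nat \<Rightarrow> real"
  assumes n: "n \<ge> 2"
  obtains s where "s \<in> {1..n}" "f s = sort (map f [1..<n+1]) ! 0"
    "\<And>i. i \<in> {1..n} - {s} \<Longrightarrow> f i \<ge> sort (map f [1..<n+1]) ! 1"
proof -
  let ?xs = "sort (map f [1..<n+1])"
  have "length ?xs \<ge> 2" using n by simp
  then obtain a b zs where xs: "?xs = a # b # zs"
    by (metis One_nat_def Suc_le_length_iff numeral_2_eq_2)
  have "set ?xs = f ` {1..n}" by (auto simp: atLeastLessThanSuc_atLeastAtMost)
  moreover have "a \<in> set ?xs" unfolding xs by simp
  ultimately have "a \<in> f ` {1..n}" by blast
  then obtain s where s: "s \<in> {1..n}" "f s = a" by auto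
  \<comment> \<open>Multisets are needed: removing the index \<open>s\<close> removes exactly one
    copy of the smallest value, and a tie leaves another copy behind.\<close>
  have "mset ?xs = image_mset f (mset [1..<n+1])"
    by (simp del: upt_Suc)
  also have "mset [1..<n+1] = mset_set {1..n}"
    unfolding mset_upt by (rule arg_cong[of _ _ mset_set]) auto
  also have "mset_set {1..n} = add_mset s (mset_set ({1..n} - {s}))"
    using s(1) by (simp add: mset_set.remove)
  finally have "mset (b # zs) = image_mset f (mset_set ({1..n} - {s}))"
    unfolding xs using s(2) by simp
  then have "set (b # zs) = f ` ({1..n} - {s})"
    by (metis finite_Diff finite_atLeastAtMost finite_set_mset_mset_set set_image_mset set_mset_mset)
  moreover have "sorted (a # b # zs)" unfolding xs[symmetric] by (rule sorted_sort)
  ultimately have "f i \<ge> b" if "i \<in> {1..n} - {s}" for i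
  proof -
    have "f i \<in> set (b # zs)" using \<open>set (b # zs) = _\<close> that by blast
    then show ?thesis using \<open>sorted (a # b # zs)\<close> by auto
  qed
  then show ?thesis using that[of s, unfolded xs] s by simp
qed

theorem theorem3:
  fixes \<eta> \<alpha> :: real
  assumes "\<eta> > 1" and "0 < \<alpha>" and "\<alpha> < 1 - 1 / \<eta>"
  shows "\<exists>C>0. \<exists>c>0. \<forall>n r :: nat. n > r \<and> r \<ge> 1 \<longrightarrow>
    (\<exists>d>0. real d \<le> C * (real r * ln (real n)) powr (1 / \<alpha>) \<and>
      (\<forall>D\<ge>r. \<forall>(S :: nat \<Rightarrow> real vec set) q.
        (\<forall>i\<in>{1..n}. linear_subspace_of_dim D r (S i)) \<and> q \<in> carrier_vec D \<longrightarrow>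
        (let \<xi> = sort (map (\<lambda>i. l1_dist q (S i)) [1..<n+1]) in
          \<xi> ! 0 > 0 \<and> \<xi> ! 1 / \<xi> ! 0 \<ge> \<eta> \<longrightarrow>
          measure (cauchy_matrix_law d D)
            {\<omega> \<in> space (cauchy_matrix_law d D).
              arg_min_set (\<lambda>i. l1_dist (mat d D \<omega> *\<^sub>v q) ((*\<^sub>v) (mat d D \<omega>) ` S i)) {1..n}
              = arg_min_set (\<lambda>i. l1_dist q (S i)) {1..n}} \<ge> c)))"
proof -
  obtain C c e K :: real where C: "C > 0" "c > 0" and e: "0 < e" "e < 1" and K: "K > 0" and
    params: "\<And>n r :: nat. n > r \<Longrightarrow> r \<ge> 1 \<Longrightarrow> \<exists>(d::nat) t (M::nat). d > 0 \<and>
      real d \<le> C * (real r * ln (real n)) powr (1 / \<alpha>) \<and> t > 0 \<and> M > 0 \<and>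
      real (Suc r) * (t + 1) \<le> e * M \<and>
      (1 - e) * (ln (1 + (real d powr (1 - \<alpha>))\<^sup>2) / pi) \<ge> 1 \<and>
      (1 + e)\<^sup>2 * ln (1 + (K * d)\<^sup>2) < (1 - e)\<^sup>2 * ln (1 + (real d powr (1 - \<alpha>))\<^sup>2) * \<eta> \<and>
      1 / (1 + e) + 1 / K + n * (Suc r * d / t + (4 * real M + 1) ^ Suc r *
        exp (- (e\<^sup>2 / 2 * d * (ln (1 + (real d powr (1 - \<alpha>))\<^sup>2) / pi) / (real d powr (1 - \<alpha>))))) \<le> 1 - c"
    using sketch_parameters_exist[OF assms] by blast
  show ?thesis
  proof (rule exI[of _ C], rule conjI[OF C(1)], rule exI[of _ c], rule conjI[OF C(2)], intro allI impI)
    fix n r :: nat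
    assume nr: "n > r \<and> r \<ge> 1"
    obtain d t M where d: "d > 0" "real d \<le> C * (real r * ln (real n)) powr (1 / \<alpha>)"
      and t: "t > 0" and M: "M > 0" "real (Suc r) * (t + 1) \<le> e * real M"
      and num: "(1 - e) * (ln (1 + (real d powr (1 - \<alpha>))\<^sup>2) / pi) \<ge> 1"
      "(1 + e)\<^sup>2 * ln (1 + (K * d)\<^sup>2) < (1 - e)\<^sup>2 * ln (1 + (real d powr (1 - \<alpha>))\<^sup>2) * \<eta>"
      "1 / (1 + e) + 1 / K + n * (Suc r * d / t + (4 * real M + 1) ^ Suc r *
        exp (- (e\<^sup>2 / 2 * d * (ln (1 + (real d powr (1 - \<alpha>))\<^sup>2) / pi) / (real d powr (1 - \<alpha>))))) \<le> 1 - c"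
      using params[of r n] nr by blast
    have B: "real d powr (1 - \<alpha>) > 0" using d by simp
    have "measure (cauchy_matrix_law d D)
            {\<omega> \<in> space (cauchy_matrix_law d D).
              arg_min_set (\<lambda>i. l1_dist (mat d D \<omega> *\<^sub>v q) ((*\<^sub>v) (mat d D \<omega>) ` S i)) {1..n}
              = arg_min_set (\<lambda>i. l1_dist q (S i)) {1..n}} \<ge> c"
      if sub: "\<forall>i\<in>{1..n}. linear_subspace_of_dim D r (S i)" and q: "q \<in> carrier_vec D"
        and \<xi>: "sort (map (\<lambda>i. l1_dist q (S i)) [1..<n+1]) ! 0 > 0"
        "sort (map (\<lambda>i. l1_dist q (S i)) [1..<n+1]) ! 1 / sort (map (\<lambda>i. l1_dist q (S i)) [1..<n+1]) ! 0 \<ge> \<eta>"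
      for D and S :: "nat \<Rightarrow> real vec set" and q
    proof -
      have "\<forall>i\<in>{1..n}. \<exists>w. S i = range (\<lambda>a. vec D (lin_comb r a w))"
        using sub linear_subspace_of_dim_eq_range by metis
      then obtain w where w: "\<And>i. i \<in> {1..n} \<Longrightarrow> S i = range (\<lambda>a. vec D (lin_comb r a (w i)))"
        by metis
      define \<delta> where "\<delta> i = (INF a. norm1 D (\<lambda>j. q $ j - lin_comb r a (w i) j))" for i
      have \<delta>: "l1_dist q (S i) = \<delta> i" if "i \<in> {1..n}" for i
        unfolding w[OF that] \<delta>_def by (rule l1_dist_range[OF q])
      \<comment> \<open>Ensures that position 1 of the sorted list exists.\<close>
      have n2: "n \<ge> 2" using nr by simp
      obtain s where s: "s \<in> {1..n}" and s0: "l1_dist q (S s) = sort (map (\<lambda>i. l1_dist q (S i)) [1..<n+1]) ! 0"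
        and s1: "\<And>i. i \<in> {1..n} - {s} \<Longrightarrow> l1_dist q (S i) \<ge> sort (map (\<lambda>i. l1_dist q (S i)) [1..<n+1]) ! 1"
        using sort_map_first_two[OF n2, of "\<lambda>i. l1_dist q (S i)"] by metis
      have \<delta>s: "\<delta> s > 0" using \<xi>(1) s0 \<delta>[OF s] by simp
      have others: "\<delta> i \<ge> \<eta> * \<delta> s" if i: "i \<in> {1..n} - {s}" for i
      proof -
        have "\<eta> * \<delta> s \<le> sort (map (\<lambda>i. l1_dist q (S i)) [1..<n+1]) ! 1"
          using \<xi> s0 \<delta>[OF s] by (simp add: pos_le_divide_eq)
        also have "\<dots> \<le> \<delta> i" using s1[OF i] \<delta>[of i] i by simp
        finally show ?thesis .
      qed
      have "\<delta> s < \<delta> i" if "i \<in> {1..n} - {s}" for i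
      proof -
        have "1 * \<delta> s < \<eta> * \<delta> s" using \<delta>s assms(1) by (intro mult_strict_right_mono)
        then show ?thesis using others[OF that] by simp
      qed
      then have am: "arg_min_set (\<lambda>i. l1_dist q (S i)) {1..n} = {s}"
        using s \<delta> by (subst arg_min_set_eq_singleton_iff) auto
      have dist: "l1_dist (mat d D \<omega> *\<^sub>v q) ((*\<^sub>v) (mat d D \<omega>) ` S i)
          = (INF a. sketch_norm d D \<omega> (\<lambda>j. q $ j - lin_comb r a (w i) j))" if "i \<in> {1..n}" for i \<omega>
        unfolding w[OF that] by (rule l1_dist_sketch_range[OF q])
      \<comment> \<open>The true minimizer is unique, so equality of the two sets also forces
        uniqueness after sketching. Hence the event is a finite conjunction of strict inequalities
        between measurable functions.\<close>
      have event: "arg_min_set (\<lambda>i. l1_dist (mat d D \<omega> *\<^sub>v q) ((*\<^sub>v) (mat d D \<omega>) ` S i)) {1..n}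
            = arg_min_set (\<lambda>i. l1_dist q (S i)) {1..n}
          \<longleftrightarrow> (\<forall>i\<in>{1..n} - {s}. (INF a. sketch_norm d D \<omega> (\<lambda>j. q $ j - lin_comb r a (w s) j))
            < (INF a. sketch_norm d D \<omega> (\<lambda>j. q $ j - lin_comb r a (w i) j)))" for \<omega>
        unfolding am arg_min_set_eq_singleton_iff[OF s] dist[OF s]
        by (rule ball_cong[OF refl]) (simp only: dist DiffD1)
      have "cauchy_matrix.prob d D {\<omega> \<in> space (cauchy_matrix_law d D). \<forall>i\<in>{1..n} - {s}.
          (INF a. sketch_norm d D \<omega> (\<lambda>j. q $ j - lin_comb r a (w s) j))
            < (INF a. sketch_norm d D \<omega> (\<lambda>j. q $ j - lin_comb r a (w i) j))} \<ge> c"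
        by (rule nearest_subspace_preserved[OF B e t d(1) K M num s])
          (use \<delta>s others in \<open>simp_all add: \<delta>_def\<close>)
      then show ?thesis unfolding event .
    qed
    then show "\<exists>d>0. real d \<le> C * (real r * ln (real n)) powr (1 / \<alpha>) \<and>
      (\<forall>D\<ge>r. \<forall>(S :: nat \<Rightarrow> real vec set) q.
        (\<forall>i\<in>{1..n}. linear_subspace_of_dim D r (S i)) \<and> q \<in> carrier_vec D \<longrightarrow>
        (let \<xi> = sort (map (\<lambda>i. l1_dist q (S i)) [1..<n+1]) in
          \<xi> ! 0 > 0 \<and> \<xi> ! 1 / \<xi> ! 0 \<ge> \<eta> \<longrightarrow>
          measure (cauchy_matrix_law d D)
            {\<omega> \<in> space (cauchy_matrix_law d D).
              arg_min_set (\<lambda>i. l1_dist (mat d D \<omega> *\<^sub>v q) ((*\<^sub>v) (mat d D \<omega>) ` S i)) {1..n}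
              = arg_min_set (\<lambda>i. l1_dist q (S i)) {1..n}} \<ge> c))"
      using d unfolding Let_def by blast
  qed
qed

end
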